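(* The space $\operatorname{sNCQSym}$, equipped with the product of $\mathbb{Q}^\theta\langle\langle x\rangle\rangle$ and the coproduct $\Delta$, is a graded Hopf superalgebra (with the usual counit and antipode), with respect to the $\mathbb{Z}_2$-grading $\operatorname{sNCQSym}=\operatorname{sNCQSym}_0\oplus\operatorname{sNCQSym}_1$, where $\operatorname{sNCQSym}_0$ (resp. $\operatorname{sNCQSym}_1$) is spanned by the $M_I$ with $I$ having an even (resp. odd) number of fermionic blocks.
   Context: $\mathbb{Q}^\theta\langle\langle x\rangle\rangle$ is the algebra of formal power series of bounded degree over $\mathbb{Q}$ in noncommuting variables $x=(x_1,x_2,\ldots)$ and variables $\theta=(\theta_1,\theta_2,\ldots)$ subject only to $x_i\theta_j=\theta_jx_i$ and $\theta_i\theta_j=-\theta_j\theta_i$. Monomials are written in normal form $q\,\theta_{i_1}\cdots\theta_{i_m}x_{j_1}\cdots x_{j_n}$ with $i_1<\cdots<i_m$. The index set of $u=\theta_{i_1}\cdots\theta_{i_m}x_{j_1}\cdots x_{j_n}$ is $\operatorname{ind}(u)=\{i_1,\ldots,i_m,j_1,\ldots,j_n\}$; if $a\mapsto a^*$ is the order-preserving bijection $\operatorname{ind}(u)\to[k]$, $k=|\operatorname{ind}(u)|$, the standardization is $\operatorname{std}(u)=\theta_{i_1^*}\cdots\theta_{i_m^*}x_{j_1^*}\cdots x_{j_n^*}$. $\operatorname{sNCQSym}$ is the set of $f\in\mathbb{Q}^\theta\langle\langle x\rangle\rangle$ in which any two monic monomials with the same standardization have the same coefficient. A set supercomposition of bidegree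 $(n,m)$ is a sequence $I=(I_1,\ldots,I_k)$ of nonempty subsets of $\{0,1,\ldots,n\}$ with $I_i\cap I_j\subseteq\{0\}$ for $i\neq j$, $\bigcup_i(I_i\setminus\{0\})=[n]$, and exactly $m$ blocks containing $0$ (the fermionic blocks). For a monic monomial $u$ with $\operatorname{std}(u)=\theta_{i_1}\cdots\theta_{i_m}x_{j_1}\cdots x_{j_n}$ and $k=|\operatorname{ind}(u)|$, let $I(u)=(I_1,\ldots,I_k)$ with $I_r=\{t\in[n]: j_t=r\}\cup(\{0\}$ if $r\in\{i_1,\ldots,i_m\})$. Put $M_I=\sum_{u:\,I(u)=I}u$ (sum over monic monomials); the $M_I$ form a basis of $\operatorname{sNCQSym}$. Coproduct: let $\mathbb{Q}^{\theta,\vartheta}\langle\langle x,y\rangle\rangle$ be the analogous algebra in noncommuting $x=(x_i),y=(y_j)$ and anticommuting $\theta=(\theta_i),\vartheta=(\vartheta_j)$ ($\theta,\vartheta$ anticommute with each other and commute with $x,y$). Totally order $x\cup y$ by $x_1<x_2<\cdots<y_1<y_2<\cdots$ and $\theta\cup\vartheta$ likewise, and let $M_I(x,y;\theta,\vartheta)$ be $M_I$ evaluated on these ordered alphabets (the pair $(x_i,\theta_i)$ and $(y_j,\vartheta_j)$ sharing the same index position). Projecting modulo $x_iy_j=y_jx_i$ identifies the result with an element of the super tensor product $\mathbb{Q}^\theta\langle\langle x\rangle\rangle\otimes\mathbb{Q}^\vartheta\langle\langle y\rangle\rangle$ (multiplication $(f_1\otimes g_1)(f_2\otimes g_2)=(-1)^{|f_2||g_1|}f_1f_2\otimes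 g_1g_2$), lying in $\operatorname{sNCQSym}\otimes\operatorname{sNCQSym}$; this defines $\Delta(M_I)$, extended linearly. *)

theory Defs
  imports
    Complex_Main
    "HOL-Library.FSet"
    "HOL-Library.Function_Algebras"
    "HOL-Library.Product_Plus"
    "HOL-Library.Z2"
begin

section \<open>Graded Hopf superalgebras\<close>

text \<open>
  Vector spaces are subspaces of the function spaces \<open>'m \<Rightarrow> 'k\<close> over a field \<open>'k\<close>. In this setting
  the tensor product of \<open>V\<close> and \<open>W\<close> is the space of functions of two arguments spanned by the
  functions \<open>(u, v) \<mapsto> f u * g v\<close> with \<open>f \<in> V\<close>, \<open>g \<in> W\<close> (over a field the canonical map from the
  abstract tensor product to this space is injective).
\<close>

definition fscale :: "'k::field \<Rightarrow> ('m \<Rightarrow> 'k) \<Rightarrow> 'm \<Rightarrow> 'k" where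
  "fscale c f = (\<lambda>u. c * f u)"

interpretation fun_space: vector_space fscale
  by unfold_locales (auto simp: fscale_def fun_eq_iff algebra_simps)

definition linear_on ::
  "('m \<Rightarrow> 'k::field) set \<Rightarrow> ('k \<Rightarrow> 'b \<Rightarrow> 'b::ab_group_add) \<Rightarrow> (('m \<Rightarrow> 'k) \<Rightarrow> 'b) \<Rightarrow> bool" where
  "linear_on V scale L \<longleftrightarrow>
     (\<forall>f\<in>V. \<forall>g\<in>V. L (f + g) = L f + L g) \<and> (\<forall>c. \<forall>f\<in>V. L (fscale c f) = scale c (L f))"

definition bilinear_on ::
  "('m \<Rightarrow> 'k::field) set \<Rightarrow> ('n \<Rightarrow> 'k) set \<Rightarrow>
   (('m \<Rightarrow> 'k) \<Rightarrow> ('n \<Rightarrow> 'k) \<Rightarrow> 'p \<Rightarrow> 'k) \<Rightarrow> bool" where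
  "bilinear_on V W B \<longleftrightarrow>
     (\<forall>f\<in>V. linear_on W fscale (B f)) \<and> (\<forall>g\<in>W. linear_on V fscale (\<lambda>f. B f g))"

definition tensor :: "('m \<Rightarrow> 'k::field) \<Rightarrow> ('n \<Rightarrow> 'k) \<Rightarrow> 'm \<times> 'n \<Rightarrow> 'k"  (infixr \<open>\<otimes>\<^sub>v\<close> 72) where
  "f \<otimes>\<^sub>v g = (\<lambda>(u, v). f u * g v)"

definition tensor_space ::
  "('m \<Rightarrow> 'k::field) set \<Rightarrow> ('n \<Rightarrow> 'k) set \<Rightarrow> ('m \<times> 'n \<Rightarrow> 'k) set"  (infixr \<open>\<otimes>\<^sub>S\<close> 72) where
  "V \<otimes>\<^sub>S W = fun_space.span {f \<otimes>\<^sub>v g |f g. f \<in> V \<and> g \<in> W}"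

text \<open>
  The linear map on the tensor product induced by a map \<open>B\<close> that is bilinear on \<open>V \<times> W\<close>
  (universal property); it is determined on \<open>V \<otimes>\<^sub>S W\<close> and only used there.
\<close>

definition tensor_lift ::
  "('m \<Rightarrow> 'k::field) set \<Rightarrow> ('n \<Rightarrow> 'k) set \<Rightarrow>
   (('m \<Rightarrow> 'k) \<Rightarrow> ('n \<Rightarrow> 'k) \<Rightarrow> 'p \<Rightarrow> 'k) \<Rightarrow> ('m \<times> 'n \<Rightarrow> 'k) \<Rightarrow> 'p \<Rightarrow> 'k" where
  "tensor_lift V W B =
     (SOME L. linear_on (V \<otimes>\<^sub>S W) fscale L \<and> (\<forall>f\<in>V. \<forall>g\<in>W. L (f \<otimes>\<^sub>v g) = B f g))"

definition tensor_map ::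
  "('m \<Rightarrow> 'k::field) set \<Rightarrow> ('n \<Rightarrow> 'k) set \<Rightarrow> (('m \<Rightarrow> 'k) \<Rightarrow> 'p \<Rightarrow> 'k) \<Rightarrow> (('n \<Rightarrow> 'k) \<Rightarrow> 'q \<Rightarrow> 'k) \<Rightarrow>
   ('m \<times> 'n \<Rightarrow> 'k) \<Rightarrow> 'p \<times> 'q \<Rightarrow> 'k" where
  "tensor_map V W \<phi> \<psi> = tensor_lift V W (\<lambda>f g. \<phi> f \<otimes>\<^sub>v \<psi> g)"

definition tensor_assoc :: "('m \<times> ('n \<times> 'p) \<Rightarrow> 'k) \<Rightarrow> ('m \<times> 'n) \<times> 'p \<Rightarrow> 'k" where
  "tensor_assoc t = (\<lambda>((u, v), w). t (u, (v, w)))"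

text \<open>
  \<open>A\<close> is the internal direct sum of the subspaces \<open>G i\<close>. The index type is a commutative monoid;
  \<open>\<int>\<^sub>2\<close>-gradings are indexed by the two-element field \<^typ>\<open>bit\<close>.
\<close>

definition direct_sum :: "('m \<Rightarrow> 'k::field) set \<Rightarrow> ('g \<Rightarrow> ('m \<Rightarrow> 'k) set) \<Rightarrow> bool" where
  "direct_sum A G \<longleftrightarrow>
     fun_space.subspace A \<and> (\<forall>i. fun_space.subspace (G i) \<and> G i \<subseteq> A) \<and>
     (\<forall>f\<in>A. \<exists>!h. (\<forall>i. h i \<in> G i) \<and> finite {i. h i \<noteq> 0} \<and> (\<Sum>i | h i \<noteq> 0. h i) = f)"

definition tensor_grading ::
  "('g::comm_monoid_add \<Rightarrow> ('m \<Rightarrow> 'k::field) set) \<Rightarrow> 'g \<Rightarrow> ('m \<times> 'm \<Rightarrow> 'k) set" where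
  "tensor_grading G a =
     fun_space.span {f \<otimes>\<^sub>v g |f g. \<exists>i j. f \<in> G i \<and> g \<in> G j \<and> i + j = a}"

definition koszul_sign :: "bit \<Rightarrow> bit \<Rightarrow> 'k::field" where
  "koszul_sign p q = (if p = 1 \<and> q = 1 then -1 else 1)"

text \<open>
  The multiplication of the super tensor product of \<open>A = P 0 \<oplus> P 1\<close> with itself, i.e. the bilinear
  map with \<open>(f\<^sub>1 \<otimes> g\<^sub>1)(f\<^sub>2 \<otimes> g\<^sub>2) = (-1)\<^bsup>|f\<^sub>2||g\<^sub>1|\<^esup> f\<^sub>1f\<^sub>2 \<otimes> g\<^sub>1g\<^sub>2\<close> for homogeneous \<open>g\<^sub>1\<close>, \<open>f\<^sub>2\<close>.
\<close>

definition super_tensor_mult ::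
  "('m \<Rightarrow> 'k::field) set \<Rightarrow> (bit \<Rightarrow> ('m \<Rightarrow> 'k) set) \<Rightarrow> (('m \<Rightarrow> 'k) \<Rightarrow> ('m \<Rightarrow> 'k) \<Rightarrow> ('m \<Rightarrow> 'k)) \<Rightarrow>
   ('m \<times> 'm \<Rightarrow> 'k) \<Rightarrow> ('m \<times> 'm \<Rightarrow> 'k) \<Rightarrow> 'm \<times> 'm \<Rightarrow> 'k" where
  "super_tensor_mult A P mult =
     (SOME \<mu>. bilinear_on (A \<otimes>\<^sub>S A) (A \<otimes>\<^sub>S A) \<mu> \<and>
        (\<forall>p q. \<forall>f\<^sub>1\<in>A. \<forall>g\<^sub>1\<in>P p. \<forall>f\<^sub>2\<in>P q. \<forall>g\<^sub>2\<in>A.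
           \<mu> (f\<^sub>1 \<otimes>\<^sub>v g\<^sub>1) (f\<^sub>2 \<otimes>\<^sub>v g\<^sub>2) =
             fscale (koszul_sign q p) (mult f\<^sub>1 f\<^sub>2 \<otimes>\<^sub>v mult g\<^sub>1 g\<^sub>2)))"

locale superalgebra =
  fixes A :: "('m \<Rightarrow> 'k::field) set"
    and P :: "bit \<Rightarrow> ('m \<Rightarrow> 'k) set"
    and mult :: "('m \<Rightarrow> 'k) \<Rightarrow> ('m \<Rightarrow> 'k) \<Rightarrow> ('m \<Rightarrow> 'k)"  (infixl \<open>\<cdot>\<close> 70)
    and one :: "'m \<Rightarrow> 'k"
  assumes parity: "direct_sum A P"
    and mult_bilinear: "bilinear_on A A (\<cdot>)"
    and mult_closed: "\<lbrakk>f \<in> A; g \<in> A\<rbrakk> \<Longrightarrow> f \<cdot> g \<in> A"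
    and mult_assoc: "\<lbrakk>f \<in> A; g \<in> A; h \<in> A\<rbrakk> \<Longrightarrow> (f \<cdot> g) \<cdot> h = f \<cdot> (g \<cdot> h)"
    and one_parity: "one \<in> P 0"
    and one_left: "f \<in> A \<Longrightarrow> one \<cdot> f = f"
    and one_right: "f \<in> A \<Longrightarrow> f \<cdot> one = f"
    and mult_parity: "\<lbrakk>f \<in> P p; g \<in> P q\<rbrakk> \<Longrightarrow> f \<cdot> g \<in> P (p + q)"

locale super_coalgebra =
  fixes A :: "('m \<Rightarrow> 'k::field) set"
    and P :: "bit \<Rightarrow> ('m \<Rightarrow> 'k) set"
    and \<Delta> :: "('m \<Rightarrow> 'k) \<Rightarrow> ('m \<times> 'm \<Rightarrow> 'k)"
    and \<epsilon> :: "('m \<Rightarrow> 'k) \<Rightarrow> 'k"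
  assumes parity: "direct_sum A P"
    and comult_linear: "linear_on A fscale \<Delta>"
    and comult_closed: "f \<in> A \<Longrightarrow> \<Delta> f \<in> A \<otimes>\<^sub>S A"
    and comult_parity: "f \<in> P p \<Longrightarrow> \<Delta> f \<in> tensor_grading P p"
    and counit_linear: "linear_on A (*) \<epsilon>"
    and counit_parity: "f \<in> P 1 \<Longrightarrow> \<epsilon> f = 0"
    and coassoc: "f \<in> A \<Longrightarrow>
          tensor_map A A \<Delta> id (\<Delta> f) = tensor_assoc (tensor_map A A id \<Delta> (\<Delta> f))"
    and counit_left: "f \<in> A \<Longrightarrow> tensor_lift A A (\<lambda>g h. fscale (\<epsilon> g) h) (\<Delta> f) = f"
    and counit_right: "f \<in> A \<Longrightarrow> tensor_lift A A (\<lambda>g h. fscale (\<epsilon> h) g) (\<Delta> f) = f"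

locale super_bialgebra =
  superalgebra A P mult one + super_coalgebra A P \<Delta> \<epsilon>
  for A :: "('m \<Rightarrow> 'k::field) set" and P mult one \<Delta> \<epsilon> +
  assumes comult_mult: "\<lbrakk>f \<in> A; g \<in> A\<rbrakk> \<Longrightarrow>
          \<Delta> (mult f g) = super_tensor_mult A P mult (\<Delta> f) (\<Delta> g)"
    and comult_one: "\<Delta> one = one \<otimes>\<^sub>v one"
    and counit_mult: "\<lbrakk>f \<in> A; g \<in> A\<rbrakk> \<Longrightarrow> \<epsilon> (mult f g) = \<epsilon> f * \<epsilon> g"
    and counit_one: "\<epsilon> one = 1"

locale hopf_superalgebra =
  super_bialgebra A P mult one \<Delta> \<epsilon>
  for A :: "('m \<Rightarrow> 'k::field) set" and P mult one \<Delta> \<epsilon> +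
  fixes S :: "('m \<Rightarrow> 'k) \<Rightarrow> ('m \<Rightarrow> 'k)"
  assumes antipode_linear: "linear_on A fscale S"
    and antipode_closed: "f \<in> A \<Longrightarrow> S f \<in> A"
    and antipode_parity: "f \<in> P p \<Longrightarrow> S f \<in> P p"
    and antipode_left: "f \<in> A \<Longrightarrow>
          tensor_lift A A mult (tensor_map A A S id (\<Delta> f)) = fscale (\<epsilon> f) one"
    and antipode_right: "f \<in> A \<Longrightarrow>
          tensor_lift A A mult (tensor_map A A id S (\<Delta> f)) = fscale (\<epsilon> f) one"

locale graded_hopf_superalgebra =
  hopf_superalgebra A P mult one \<Delta> \<epsilon> S
  for A :: "('m \<Rightarrow> 'k::field) set" and P mult one \<Delta> \<epsilon> S +
  fixes G :: "'g::comm_monoid_add \<Rightarrow> ('m \<Rightarrow> 'k) set"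
  assumes grading: "direct_sum A G"
    and grading_parity: "direct_sum (G a) (\<lambda>p. G a \<inter> P p)"
    and mult_degree: "\<lbrakk>f \<in> G a; g \<in> G b\<rbrakk> \<Longrightarrow> mult f g \<in> G (a + b)"
    and one_degree: "one \<in> G 0"
    and comult_degree: "f \<in> G a \<Longrightarrow> \<Delta> f \<in> tensor_grading G a"
    and counit_degree: "\<lbrakk>f \<in> G a; a \<noteq> 0\<rbrakk> \<Longrightarrow> \<epsilon> f = 0"
    and antipode_degree: "f \<in> G a \<Longrightarrow> S f \<in> G a"


section \<open>Power series in commuting and anticommuting variables\<close>

text \<open>
  For an ordered alphabet \<open>'i\<close>, the pair \<open>(A, [j\<^sub>1,\<dots>,j\<^sub>n])\<close> is the monic monomial
  \<open>\<theta>\<^bsub>i\<^sub>1\<^esub>\<dots>\<theta>\<^bsub>i\<^sub>m\<^esub> x\<^bsub>j\<^sub>1\<^esub>\<dots>x\<^bsub>j\<^sub>n\<^esub>\<close> in normal form, where \<open>A = {i\<^sub>1 < \<dots> < i\<^sub>m}\<close>; a series is its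
  coefficient function. The alphabet \<open>x\<^sub>1, x\<^sub>2, \<dots>\<close> is indexed from \<open>0\<close> by the type \<^typ>\<open>nat\<close>.
\<close>

type_synonym 'i mono = "'i fset \<times> 'i list"
type_synonym 'i series = "'i mono \<Rightarrow> rat"

definition mono_degree :: "'i mono \<Rightarrow> nat" where
  "mono_degree u = fcard (fst u) + length (snd u)"

definition bounded_degree :: "'i series \<Rightarrow> bool" where
  "bounded_degree f \<longleftrightarrow> (\<exists>d. \<forall>u. f u \<noteq> 0 \<longrightarrow> mono_degree u \<le> d)"

text \<open>
  The product of two monic monomials is \<open>mono_sign u v\<close> times the monic monomial \<open>mono_mult u v\<close>:
  it vanishes if a \<open>\<theta>\<^sub>i\<close> is repeated, and otherwise sorting the \<open>\<theta>\<close>'s produces one sign per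
  inversion, while moving the \<open>\<theta>\<close>'s past the \<open>x\<close>'s produces none.
\<close>

definition mono_mult :: "'i mono \<Rightarrow> 'i mono \<Rightarrow> 'i mono" where
  "mono_mult u v = (fst u |\<union>| fst v, snd u @ snd v)"

definition mono_sign :: "'i::linorder mono \<Rightarrow> 'i mono \<Rightarrow> rat" where
  "mono_sign u v =
     (if fst u |\<inter>| fst v \<noteq> {||} then 0
      else (-1) ^ card {(a, b). a |\<in>| fst u \<and> b |\<in>| fst v \<and> b < a})"

definition series_mult :: "'i::linorder series \<Rightarrow> 'i series \<Rightarrow> 'i series" where
  "series_mult f g = (\<lambda>w. \<Sum>(u, v) | mono_mult u v = w. mono_sign u v * f u * g v)"

definition series_one :: "'i series" where
  "series_one = (\<lambda>u. if u = ({||}, []) then 1 else 0)"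

lemma finite_mono_factorizations: "finite {(u, v). mono_mult u v = w}"
proof -
  have "{(u, v). mono_mult u v = w} \<subseteq>
      (fset (fPow (fst w)) \<times> (\<lambda>k. take k (snd w)) ` {..length (snd w)}) \<times>
      (fset (fPow (fst w)) \<times> (\<lambda>k. drop k (snd w)) ` {..length (snd w)})"
  proof
    fix z
    assume "z \<in> {(u, v). mono_mult u v = w}"
    then obtain A p B q where z: "z = ((A, p), (B, q))" and "mono_mult (A, p) (B, q) = w"
      by (cases z) auto
    then have "fst w = A |\<union>| B" and w: "snd w = p @ q"
      by (auto simp: mono_mult_def)
    then have "A |\<in>| fPow (fst w)" and "B |\<in>| fPow (fst w)"
      by auto
    moreover have "p = take (length p) (snd w)" and "q = drop (length p) (snd w)"
      and "length p \<le> length (snd w)"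
      using w by auto
    ultimately show "z \<in>
        (fset (fPow (fst w)) \<times> (\<lambda>k. take k (snd w)) ` {..length (snd w)}) \<times>
        (fset (fPow (fst w)) \<times> (\<lambda>k. drop k (snd w)) ` {..length (snd w)})"
      unfolding z by blast
  qed
  then show ?thesis
    by (rule finite_subset) (intro finite_cartesian_product finite_fset finite_imageI finite_atMost)
qed


section \<open>Quasi-symmetric functions in noncommuting variables in superspace\<close>

definition mono_ind :: "'i mono \<Rightarrow> 'i set" where
  "mono_ind u = fset (fst u) \<union> set (snd u)"

text \<open>\<open>rank_in J\<close> is the order-preserving bijection of a finite set \<open>J\<close> onto \<open>{0..<card J}\<close>.\<close>

definition rank_in :: "'i::linorder set \<Rightarrow> 'i \<Rightarrow> nat" where
  "rank_in J a = card {b \<in> J. b < a}"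

definition mono_std :: "'i::linorder mono \<Rightarrow> nat mono" where
  "mono_std u = (rank_in (mono_ind u) |`| fst u, map (rank_in (mono_ind u)) (snd u))"

definition sNCQSym :: "nat series set" where
  "sNCQSym = {f. bounded_degree f \<and> (\<forall>u v. mono_std u = mono_std v \<longrightarrow> f u = f v)}"

text \<open>
  In a set supercomposition, \<open>1,\<dots>,n\<close> stand for the positions in the word of \<open>x\<close>'s, and \<open>0\<close> marks
  a fermionic block.
\<close>

definition set_supercomposition :: "nat \<Rightarrow> nat \<Rightarrow> nat set list \<Rightarrow> bool" where
  "set_supercomposition n m I \<longleftrightarrow>
     (\<forall>r<length I. I ! r \<noteq> {} \<and> I ! r \<subseteq> {0..n}) \<and>
     (\<forall>r<length I. \<forall>s<length I. r \<noteq> s \<longrightarrow> I ! r \<inter> I ! s \<subseteq> {0}) \<and>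
     (\<Union>r<length I. I ! r - {0}) = {1..n} \<and>
     card {r. r < length I \<and> 0 \<in> I ! r} = m"

definition mono_supercomp :: "'i::linorder mono \<Rightarrow> nat set list" where
  "mono_supercomp u =
     map (\<lambda>r. {t \<in> {1..length (snd u)}. snd (mono_std u) ! (t - 1) = r} \<union>
              (if r |\<in>| fst (mono_std u) then {0} else {}))
       [0..<card (mono_ind u)]"

definition M :: "nat set list \<Rightarrow> 'i::linorder series" where
  "M I = (\<lambda>u. if mono_supercomp u = I then 1 else 0)"

definition sNCQSym_parity :: "bit \<Rightarrow> nat series set" where
  "sNCQSym_parity p =
     fun_space.span {M I |I n m. set_supercomposition n m I \<and> (if even m then 0 else 1) = p}"

definition sNCQSym_bidegree :: "nat \<times> nat \<Rightarrow> nat series set" where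
  "sNCQSym_bidegree = (\<lambda>(n, m). fun_space.span {M I |I. set_supercomposition n m I})"


section \<open>The coproduct\<close>

text \<open>
  The alphabet \<open>x\<^sub>1 < x\<^sub>2 < \<dots> < y\<^sub>1 < y\<^sub>2 < \<dots>\<close>, together with the \<open>\<theta>\<close>'s and \<open>\<vartheta>\<close>'s, is the ordinal sum
  \<^typ>\<open>nat + nat\<close>, with \<open>Inl i\<close> indexing \<open>x\<close> and \<open>\<theta>\<close>, and \<open>Inr j\<close> indexing \<open>y\<close> and \<open>\<vartheta>\<close>.
\<close>

instantiation sum :: (linorder, linorder) linorder
begin

definition less_eq_sum :: "'a + 'b \<Rightarrow> 'a + 'b \<Rightarrow> bool" where
  "less_eq_sum a b = (case (a, b) of
       (Inl i, Inl j) \<Rightarrow> i \<le> j | (Inl i, Inr j) \<Rightarrow> True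
     | (Inr i, Inl j) \<Rightarrow> False | (Inr i, Inr j) \<Rightarrow> i \<le> j)"

definition less_sum :: "'a + 'b \<Rightarrow> 'a + 'b \<Rightarrow> bool" where
  "less_sum a b \<longleftrightarrow> a \<le> b \<and> \<not> b \<le> (a :: 'a + 'b)"

instance
  by intro_classes (auto simp: less_eq_sum_def less_sum_def split: sum.splits)

end

text \<open>
  Modulo \<open>x\<^sub>iy\<^sub>j = y\<^sub>jx\<^sub>i\<close>, a monomial in both alphabets becomes the product of its part \<open>u\<close> in
  \<open>\<theta>, x\<close> and its part \<open>v\<close> in \<open>\<vartheta>, y\<close>, identified with \<open>u \<otimes> v\<close>. There is no sign, because in normal
  form the \<open>\<theta>\<close>'s precede the \<open>\<vartheta>\<close>'s.
\<close>

definition mono_split :: "('i + 'j) mono \<Rightarrow> 'i mono \<times> 'j mono" where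
  "mono_split w =
     ((projl |`| ffilter isl (fst w), map projl (filter isl (snd w))),
      (projr |`| ffilter (\<lambda>a. \<not> isl a) (fst w), map projr (filter (\<lambda>a. \<not> isl a) (snd w))))"

definition project :: "('i + 'j) series \<Rightarrow> 'i mono \<times> 'j mono \<Rightarrow> rat" where
  "project F = (\<lambda>t. \<Sum>w | mono_split w = t. F w)"

lemma finite_mono_split_fibre: "finite {w. mono_split w = t}"
proof -
  define X where "X = (Inl |`| fst (fst t)) |\<union>| (Inr |`| fst (snd t))"
  define Y where "Y = Inl ` set (snd (fst t)) \<union> Inr ` set (snd (snd t))"
  have "fst w = X \<and> set (snd w) \<subseteq> Y \<and> length (snd w) = length (snd (fst t)) + length (snd (snd t))"
    if "mono_split w = t" for w
  proof (intro conjI)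
    show "fst w = X"
      unfolding X_def that[symmetric] mono_split_def
      by (force simp: fset_eq_iff fimage_iff split: sum.splits)
    show "set (snd w) \<subseteq> Y"
      unfolding Y_def that[symmetric] mono_split_def by (force simp: image_iff)
    show "length (snd w) = length (snd (fst t)) + length (snd (snd t))"
      unfolding that[symmetric] mono_split_def by (simp add: sum_length_filter_compl)
  qed
  then have "{w. mono_split w = t} \<subseteq>
      {X} \<times> {l. set l \<subseteq> Y \<and> length l = length (snd (fst t)) + length (snd (snd t))}"
    by (force simp: subset_iff)
  moreover have "finite Y"
    by (simp add: Y_def)
  then have "finite ({X} \<times>
      {l. set l \<subseteq> Y \<and> length l = length (snd (fst t)) + length (snd (snd t))})"
    by (intro finite_cartesian_product finite_lists_length_eq) auto
  ultimately show ?thesis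
    by (rule finite_subset)
qed

definition coproduct_M :: "nat set list \<Rightarrow> nat mono \<times> nat mono \<Rightarrow> rat" where
  "coproduct_M I = project (M I :: (nat + nat) series)"

text \<open>
  Linear extension from the basis of the \<open>M\<^sub>I\<close>: the coefficient of \<open>M\<^sub>I\<close> in \<open>f\<close> is the value of \<open>f\<close>
  at any monomial \<open>u\<close> with \<open>I(u) = I\<close>, and for \<open>f\<close> in \<^const>\<open>sNCQSym\<close> the sum is finite.
\<close>

definition coproduct :: "nat series \<Rightarrow> nat mono \<times> nat mono \<Rightarrow> rat" where
  "coproduct f =
     (\<Sum>I \<in> mono_supercomp ` {u. f u \<noteq> 0}. fscale (f (SOME u. mono_supercomp u = I)) (coproduct_M I))"

lemma finite_supercomp_support:
  fixes f :: "nat series"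
  assumes "f \<in> sNCQSym"
  shows "finite (mono_supercomp ` {u. f u \<noteq> 0})"
proof -
  obtain d where d: "\<And>u. f u \<noteq> 0 \<Longrightarrow> mono_degree u \<le> d"
    using assms unfolding sNCQSym_def bounded_degree_def by blast
  have "set (mono_supercomp u) \<subseteq> Pow {0..d} \<and> length (mono_supercomp u) \<le> d" if "f u \<noteq> 0" for u
  proof
    have deg: "fcard (fst u) + length (snd u) \<le> d"
      using d[OF that] by (simp add: mono_degree_def)
    then show "set (mono_supercomp u) \<subseteq> Pow {0..d}"
      by (auto simp: mono_supercomp_def split: if_splits)
    have "card (mono_ind u) \<le> card (fset (fst u)) + card (set (snd u))"
      unfolding mono_ind_def by (rule card_Un_le)
    also have "\<dots> \<le> fcard (fst u) + length (snd u)"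
      by (intro add_mono card_length) (simp add: fcard.rep_eq)
    finally show "length (mono_supercomp u) \<le> d"
      using deg by (simp add: mono_supercomp_def)
  qed
  then have "mono_supercomp ` {u. f u \<noteq> 0} \<subseteq> {I. set I \<subseteq> Pow {0..d} \<and> length I \<le> d}"
    by blast
  then show ?thesis
    by (rule finite_subset) (rule finite_lists_length_le, simp)
qed

lemma coproduct_M_basis: "coproduct (M (mono_supercomp (u :: nat mono))) = coproduct_M (mono_supercomp u)"
proof -
  let ?I = "mono_supercomp u"
  have "mono_supercomp ` {v :: nat mono. (M ?I :: nat series) v \<noteq> 0} = {?I}"
    by (auto simp: M_def)
  moreover have "(M ?I :: nat series) (SOME v. mono_supercomp v = ?I) = 1"
    by (simp add: M_def) (rule someI, rule refl)
  ultimately show ?thesis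
    by (simp add: coproduct_def fscale_def)
qed

definition counit :: "nat series \<Rightarrow> rat" where
  "counit f = f ({||}, [])"

end

theory Submission
  imports Defs
begin

text \<open>
  For a coefficient function \<open>f\<close> in \<^const>\<open>sNCQSym\<close>, the series \<open>f(x, y; \<theta>, \<vartheta>)\<close> has the coefficient
  \<open>f (std w)\<close> at the monomial \<open>w\<close> in both alphabets, so the coproduct at \<open>u \<otimes> v\<close> is the sum of
  \<open>f (std w)\<close> over the shuffles \<open>w\<close> of \<open>u\<close> and \<open>v\<close>. Standardization is invariant under order
  embeddings of alphabets. Hence evaluation on the larger alphabet is multiplicative, as is the
  projection to the super tensor product, and coassociativity reduces to the associativity of the
  ordinal sum of three alphabets. Since the bialgebra is graded and connected, a left and a right
  antipode exist by recursion on the degree, and they agree by associativity of the convolution.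
\<close>

section \<open>Tensor products of function spaces\<close>

text \<open>The maps in the axioms are choices by \<open>SOME\<close>, known only through their
  values on certain pure tensors, while \<open>coproduct\<close> is controlled only on
  \<open>sNCQSym\<close>. Both difficulties are met by total formulas: \<open>std_coproduct\<close>,
  \<open>super_mult\<close> and \<open>antipode\<close> are finite sums at each monomial and
  (bi)linear on all coefficient functions, and a chosen map equals such a formula because the two
  agree on a spanning set. Slices take the place of Sweedler components: with \<open>v\<close>
  frozen, \<open>a \<mapsto> \<Delta> f (a, v)\<close> is again a coefficient function, so a total
  map applies to it without any proof that the slice lies in \<open>sNCQSym\<close>. The price
  appears when the two antipodes are compared: maps acting in different slots must commute on
  functions of possibly infinite support. They do, since each coefficient of an antipode reads only
  finitely many coefficients of its argument.\<close>

lemma sum_fun_apply: "(\<Sum>i\<in>I. h i) u = (\<Sum>i\<in>I. h i u)"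
  by (induction I rule: infinite_finite_induct) auto

text \<open>\<open>linear_on\<close> speaks only of arguments inside the span, so the induction
  carries membership along with the equality. This is the uniqueness half of identifying a map
  chosen by \<open>SOME\<close>.\<close>

lemma linear_on_eq_on_span:
  assumes L: "linear_on (fun_space.span B) fscale L" and L': "linear_on (fun_space.span B) fscale L'"
    and eq: "\<And>b. b \<in> B \<Longrightarrow> L b = L' b" and t: "t \<in> fun_space.span B"
  shows "L t = L' t"
proof -
  have add: "L (f + g) = L f + L g" "L' (f + g) = L' f + L' g"
    if "f \<in> fun_space.span B" "g \<in> fun_space.span B" for f g
    using L L' that by (auto simp: linear_on_def)
  have scale: "L (fscale c f) = fscale c (L f)" "L' (fscale c f) = fscale c (L' f)"
    if "f \<in> fun_space.span B" for c f
    using L L' that by (auto simp: linear_on_def)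
  have zero: "L 0 = 0" "L' 0 = 0"
    using scale[of 0 0] fun_space.span_zero by (auto simp: fscale_def zero_fun_def)
  from t have "t \<in> fun_space.span B \<and> L t = L' t"
  proof (induction rule: fun_space.span_induct_alt)
    case base
    show ?case
      by (rule conjI[OF fun_space.span_zero]) (simp only: zero)
  next
    case (step c x y)
    then show ?case
      by (simp only: eq add scale fun_space.span_base fun_space.span_add fun_space.span_scale)
  qed
  then show ?thesis ..
qed

lemma tensor_in_tensor_space: "f \<in> V \<Longrightarrow> g \<in> W \<Longrightarrow> f \<otimes>\<^sub>v g \<in> V \<otimes>\<^sub>S W"
  unfolding tensor_space_def by (rule fun_space.span_base) blast

lemma tensor_space_induct [consumes 1, case_names zero add]:
  assumes "t \<in> V \<otimes>\<^sub>S W" and "Q 0"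
    and "\<And>c f g s. f \<in> V \<Longrightarrow> g \<in> W \<Longrightarrow> s \<in> V \<otimes>\<^sub>S W \<Longrightarrow> Q s \<Longrightarrow> Q (fscale c (f \<otimes>\<^sub>v g) + s)"
  shows "Q t"
proof -
  from assms(1) have "t \<in> V \<otimes>\<^sub>S W \<and> Q t"
    unfolding tensor_space_def
  proof (induction rule: fun_space.span_induct_alt)
    case base
    then show ?case
      by (rule conjI[OF fun_space.span_zero assms(2)])
  next
    case (step c x y)
    then obtain f g where x: "x = f \<otimes>\<^sub>v g" and fg: "f \<in> V" "g \<in> W"
      by blast
    have "x \<in> fun_space.span {f \<otimes>\<^sub>v g |f g. f \<in> V \<and> g \<in> W}"
      by (rule fun_space.span_base) (rule step)
    with step assms(3)[OF fg, of y c] show ?case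
      by (simp only: x tensor_space_def fun_space.span_add fun_space.span_scale)
  qed
  then show ?thesis ..
qed

lemma linear_onI_fscale:
  assumes "\<And>f g x. L (f + g) x = L f x + L g x" and "\<And>c f x. L (fscale c f) x = c * L f x"
  shows "linear_on V fscale L"
  using assms by (auto simp: linear_on_def fscale_def plus_fun_def)

lemma linear_on_fun_sum:
  assumes L: "linear_on UNIV fscale L" and "finite S"
  shows "L (\<lambda>a. \<Sum>i\<in>S. c i * F i a) x = (\<Sum>i\<in>S. c i * L (F i) x)"
  using \<open>finite S\<close>
proof (induction S)
  case empty
  have "L (fscale 0 0) x = 0 * L 0 x"
    using L unfolding linear_on_def by (metis UNIV_I fscale_def)
  then show ?case
    by (simp add: fscale_def zero_fun_def)
next
  case (insert i S)
  have "(\<lambda>a. \<Sum>i\<in>insert i S. c i * F i a) = fscale (c i) (F i) + (\<lambda>a. \<Sum>i\<in>S. c i * F i a)"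
    using insert by (auto simp: fscale_def plus_fun_def)
  moreover have "L (fscale (c i) (F i) + (\<lambda>a. \<Sum>i\<in>S. c i * F i a))
      = fscale (c i) (L (F i)) + L (\<lambda>a. \<Sum>i\<in>S. c i * F i a)"
    using L by (auto simp: linear_on_def)
  ultimately show ?case
    using insert by (simp add: fscale_def plus_fun_def)
qed

text \<open>One explicit \<open>L\<close> makes the choice in \<open>tensor_lift\<close>
  satisfiable, and since pure tensors span, the chosen map can only be \<open>L\<close> on the
  tensor space.\<close>

lemma tensor_lift_eq:
  assumes lin: "linear_on (V \<otimes>\<^sub>S W) fscale L"
    and L: "\<And>f g. f \<in> V \<Longrightarrow> g \<in> W \<Longrightarrow> L (f \<otimes>\<^sub>v g) = B f g"
    and t: "t \<in> V \<otimes>\<^sub>S W"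
  shows "tensor_lift V W B t = L t"
proof -
  let ?P = "\<lambda>L. linear_on (V \<otimes>\<^sub>S W) fscale L \<and> (\<forall>f\<in>V. \<forall>g\<in>W. L (f \<otimes>\<^sub>v g) = B f g)"
  have P: "?P (tensor_lift V W B)"
    unfolding tensor_lift_def by (rule someI[of ?P L]) (use lin L in blast)
  show ?thesis
  proof (rule linear_on_eq_on_span[OF _ _ _ t[unfolded tensor_space_def]])
    fix b assume "b \<in> {f \<otimes>\<^sub>v g |f g. f \<in> V \<and> g \<in> W}"
    then obtain f g where b: "b = f \<otimes>\<^sub>v g" and fg: "f \<in> V" "g \<in> W"
      by blast
    from P fg have "tensor_lift V W B (f \<otimes>\<^sub>v g) = B f g"
      by blast
    with L[OF fg] b show "tensor_lift V W B b = L b"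
      by simp
  qed (use P lin in \<open>auto simp: tensor_space_def\<close>)
qed

text \<open>Applying \<open>\<phi>\<close> to every slice with frozen second argument is a concrete
  form of \<open>\<phi> \<otimes> id\<close>. Linearity on \<open>UNIV\<close> spares showing that
  the slices lie in a given subspace.\<close>

lemma linear_on_apply_left:
  assumes lin: "linear_on UNIV fscale \<phi>"
  shows "linear_on X fscale (\<lambda>t (x, v). \<phi> (\<lambda>a. t (a, v)) x)"
proof -
  have "\<phi> (\<lambda>a. f a + g a) = \<phi> f + \<phi> g" for f g
    using lin unfolding linear_on_def plus_fun_def[of f g, symmetric] by blast
  moreover have "\<phi> (\<lambda>a. c * f a) = fscale c (\<phi> f)" for c f
    using lin unfolding linear_on_def fscale_def[of c f, symmetric] by blast
  ultimately show ?thesis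
    by (intro linear_onI_fscale) (auto simp: fscale_def)
qed

lemma apply_left_tensor:
  assumes lin: "linear_on UNIV fscale \<phi>"
  shows "(\<lambda>(x, v). \<phi> (\<lambda>a. (f \<otimes>\<^sub>v g) (a, v)) x) = \<phi> f \<otimes>\<^sub>v g"
proof -
  have scale: "\<phi> (\<lambda>a. c * f a) = fscale c (\<phi> f)" for c f
    using lin unfolding linear_on_def fscale_def[of c f, symmetric] by blast
  show ?thesis
    using scale[of "g _" f] by (auto simp: tensor_def fscale_def mult.commute)
qed

text \<open>Pure tensors only see values on \<open>V\<close>, so a total linear
  \<open>\<phi>'\<close> may replace a \<open>\<phi>\<close> that is controlled on \<open>V\<close>
  alone. This is how \<open>std_coproduct\<close> stands in for \<open>coproduct\<close>.\<close>

lemma tensor_map_left: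
  assumes lin: "linear_on UNIV fscale \<phi>'" and \<phi>: "\<And>f. f \<in> V \<Longrightarrow> \<phi>' f = \<phi> f"
    and t: "t \<in> V \<otimes>\<^sub>S W"
  shows "tensor_map V W \<phi> id t = (\<lambda>(x, v). \<phi>' (\<lambda>a. t (a, v)) x)"
  unfolding tensor_map_def
  by (rule tensor_lift_eq[OF linear_on_apply_left[OF lin] _ t])
    (simp only: apply_left_tensor[OF lin] \<phi> id_apply)

lemma linear_on_apply_right:
  assumes lin: "linear_on UNIV fscale \<phi>"
  shows "linear_on X fscale (\<lambda>t (v, x). \<phi> (\<lambda>a. t (v, a)) x)"
proof -
  have "\<phi> (\<lambda>a. f a + g a) = \<phi> f + \<phi> g" for f g
    using lin unfolding linear_on_def plus_fun_def[of f g, symmetric] by blast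
  moreover have "\<phi> (\<lambda>a. c * f a) = fscale c (\<phi> f)" for c f
    using lin unfolding linear_on_def fscale_def[of c f, symmetric] by blast
  ultimately show ?thesis
    by (intro linear_onI_fscale) (auto simp: fscale_def)
qed

lemma apply_right_tensor:
  assumes lin: "linear_on UNIV fscale \<phi>"
  shows "(\<lambda>(v, x). \<phi> (\<lambda>a. (f \<otimes>\<^sub>v g) (v, a)) x) = f \<otimes>\<^sub>v \<phi> g"
proof -
  have scale: "\<phi> (\<lambda>a. c * f a) = fscale c (\<phi> f)" for c f
    using lin unfolding linear_on_def fscale_def[of c f, symmetric] by blast
  show ?thesis
    using scale[of "f _" g] by (auto simp: tensor_def fscale_def)
qed

lemma tensor_map_right:
  assumes lin: "linear_on UNIV fscale \<phi>'" and \<phi>: "\<And>f. f \<in> W \<Longrightarrow> \<phi>' f = \<phi> f"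
    and t: "t \<in> V \<otimes>\<^sub>S W"
  shows "tensor_map V W id \<phi> t = (\<lambda>(v, x). \<phi>' (\<lambda>a. t (v, a)) x)"
  unfolding tensor_map_def
  by (rule tensor_lift_eq[OF linear_on_apply_right[OF lin] _ t])
    (simp only: apply_right_tensor[OF lin] \<phi> id_apply)

lemma linear_on_tensor_space_closed:
  assumes ex: "linear_on (V \<otimes>\<^sub>S W) fscale L" "\<And>f g. f \<in> V \<Longrightarrow> g \<in> W \<Longrightarrow> L (f \<otimes>\<^sub>v g) \<in> V' \<otimes>\<^sub>S W'"
    and t: "t \<in> V \<otimes>\<^sub>S W"
  shows "L t \<in> V' \<otimes>\<^sub>S W'"
proof -
  have L_add: "L (f + g) = L f + L g" if "f \<in> V \<otimes>\<^sub>S W" "g \<in> V \<otimes>\<^sub>S W" for f g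
    using ex(1) that by (auto simp: linear_on_def)
  have scale: "L (fscale c f) = fscale c (L f)" if "f \<in> V \<otimes>\<^sub>S W" for c f
    using ex(1) that by (auto simp: linear_on_def)
  have "0 \<in> V \<otimes>\<^sub>S W"
    by (simp add: tensor_space_def fun_space.span_zero)
  from scale[OF this, of 0] have L_zero: "L 0 = 0"
    by (auto simp: fscale_def zero_fun_def)
  from t show ?thesis
  proof (induction rule: tensor_space_induct)
    case zero
    then show ?case
      unfolding L_zero tensor_space_def by (rule fun_space.span_zero)
  next
    case (add c f g s)
    have fg: "f \<otimes>\<^sub>v g \<in> V \<otimes>\<^sub>S W" by (intro tensor_in_tensor_space add)
    then have "fscale c (f \<otimes>\<^sub>v g) \<in> V \<otimes>\<^sub>S W"
      by (simp add: tensor_space_def fun_space.span_scale)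
    then have "L (fscale c (f \<otimes>\<^sub>v g) + s) = fscale c (L (f \<otimes>\<^sub>v g)) + L s"
      using fg add by (simp only: L_add scale)
    also have "\<dots> \<in> V' \<otimes>\<^sub>S W'"
      using add ex(2)[of f g] unfolding tensor_space_def
      by (intro fun_space.span_add fun_space.span_scale) auto
    finally show ?case .
  qed
qed

text \<open>The components of \<open>f\<close> are its restrictions to the fibres of
  \<open>d\<close>. A support may be infinite, but \<open>d\<close> takes finitely many values on
  it, so the decomposition is finite. The lemma serves the bidegree, the parity, and the parity
  inside one bidegree.\<close>

lemma direct_sum_support:
  fixes d :: "'m \<Rightarrow> 'g" and A :: "('m \<Rightarrow> 'k::field) set"
  assumes A: "fun_space.subspace A"
    and G: "\<And>i. G i = {f \<in> A. \<forall>u. f u \<noteq> 0 \<longrightarrow> d u = i}"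
    and restrict: "\<And>f i. f \<in> A \<Longrightarrow> (\<lambda>u. if d u = i then f u else 0) \<in> A"
    and fin: "\<And>f. f \<in> A \<Longrightarrow> finite (d ` {u. f u \<noteq> 0})"
  shows "direct_sum A G"
proof -
  have sub: "fun_space.subspace (G i)" for i
    using A unfolding fun_space.subspace_def G
    by (auto simp: fscale_def) (metis add_0)
  have "\<exists>!h. (\<forall>i. h i \<in> G i) \<and> finite {i. h i \<noteq> 0} \<and> (\<Sum>i | h i \<noteq> 0. h i) = f"
    if f: "f \<in> A" for f
  proof (rule ex1I)
    let ?h = "\<lambda>i u. if d u = i then f u else 0"
    have nz: "?h i \<noteq> 0 \<longleftrightarrow> i \<in> d ` {u. f u \<noteq> 0}" for i
      by (auto simp: fun_eq_iff)
    have "(\<Sum>i | ?h i \<noteq> 0. ?h i) u = f u" for u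
    proof -
      have "(\<Sum>i | ?h i \<noteq> 0. ?h i) u = (\<Sum>i | ?h i \<noteq> 0. ?h i u)"
        by (rule sum_fun_apply)
      also have "\<dots> = f u"
        using fin[OF f] by (subst sum.delta') (auto simp: nz)
      finally show ?thesis .
    qed
    then show "(\<forall>i. ?h i \<in> G i) \<and> finite {i. ?h i \<noteq> 0} \<and> (\<Sum>i | ?h i \<noteq> 0. ?h i) = f"
      using fin[OF f] restrict[OF f] by (auto simp: G nz)
  next
    fix h assume h: "(\<forall>i. h i \<in> G i) \<and> finite {i. h i \<noteq> 0} \<and> (\<Sum>i | h i \<noteq> 0. h i) = f"
    \<comment> \<open>Only the summand of degree \<open>d u\<close> can be nonzero at
      \<open>u\<close>, which forces every component.\<close>
    have "h i u = (if d u = i then f u else 0)" for i u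
    proof -
      have "f u = (\<Sum>i | h i \<noteq> 0. h i u)"
        using h by (auto simp: sum_fun_apply)
      also have "\<dots> = (\<Sum>i | h i \<noteq> 0. if i = d u then h (d u) u else 0)"
        using h by (intro sum.cong) (auto simp: G)
      also have "\<dots> = h (d u) u"
        using h by (auto simp: sum.delta)
      finally show ?thesis
        using h by (auto simp: G)
    qed
    then show "h = (\<lambda>i u. if d u = i then f u else 0)"
      by blast
  qed
  with A sub show ?thesis
    unfolding direct_sum_def by (auto simp: G)
qed

section \<open>Monomials and their products\<close>

abbreviation factorizations :: "'i mono \<Rightarrow> ('i mono \<times> 'i mono) set" where
  "factorizations w \<equiv> {(u, v). mono_mult u v = w}"

abbreviation mono_one :: "'i mono" where
  "mono_one \<equiv> ({||}, [])"

definition mono_map :: "('i \<Rightarrow> 'j) \<Rightarrow> 'i mono \<Rightarrow> 'j mono" where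
  "mono_map \<phi> u = (\<phi> |`| fst u, map \<phi> (snd u))"

definition mono_bidegree :: "'i mono \<Rightarrow> nat \<times> nat" where
  "mono_bidegree u = (length (snd u), fcard (fst u))"

lemma finite_mono_ind [simp]: "finite (mono_ind u)"
  by (simp add: mono_ind_def)

lemma mono_ind_map: "mono_ind (mono_map \<phi> u) = \<phi> ` mono_ind u"
  by (auto simp: mono_ind_def mono_map_def)

lemma mono_ind_mult: "mono_ind (mono_mult u v) = mono_ind u \<union> mono_ind v"
  by (auto simp: mono_ind_def mono_mult_def)

lemma mono_map_mult: "mono_map \<phi> (mono_mult u v) = mono_mult (mono_map \<phi> u) (mono_map \<phi> v)"
  by (auto simp: mono_map_def mono_mult_def)

lemma mono_map_comp: "mono_map \<phi> (mono_map \<psi> u) = mono_map (\<phi> \<circ> \<psi>) u"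
  by (auto simp: mono_map_def)

lemma mono_map_cong: "(\<And>a. a \<in> mono_ind u \<Longrightarrow> \<phi> a = \<psi> a) \<Longrightarrow> mono_map \<phi> u = mono_map \<psi> u"
  by (force simp: mono_map_def mono_ind_def fset_eq_iff fimage_iff)

lemma mono_map_ident: "(\<And>a. a \<in> mono_ind u \<Longrightarrow> \<phi> a = a) \<Longrightarrow> mono_map \<phi> u = u"
  by (subst mono_map_cong[of u \<phi> id]) (auto simp: mono_map_def)

lemma mono_map_eq_one_iff [simp]: "mono_map \<phi> u = mono_one \<longleftrightarrow> u = mono_one"
  by (cases u) (auto simp: mono_map_def)

lemma mono_std_eq_map: "mono_std u = mono_map (rank_in (mono_ind u)) u"
  by (simp add: mono_std_def mono_map_def)

lemma strict_mono_on_rank_in: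
  assumes "finite J"
  shows "strict_mono_on J (rank_in J)"
  unfolding rank_in_def
  by (rule strict_mono_onI, rule psubset_card_mono) (use assms in auto)

lemma rank_in_image:
  fixes \<phi> :: "'i::linorder \<Rightarrow> 'j::linorder"
  assumes \<phi>: "strict_mono_on J \<phi>" and a: "a \<in> J"
  shows "rank_in (\<phi> ` J) (\<phi> a) = rank_in J a"
proof -
  have "{b \<in> \<phi> ` J. b < \<phi> a} = \<phi> ` {b \<in> J. b < a}"
    using strict_mono_on_less[OF \<phi> _ a] by auto
  moreover have "inj_on \<phi> {b \<in> J. b < a}"
    using strict_mono_on_imp_inj_on[OF \<phi>] by (rule inj_on_subset) auto
  ultimately show ?thesis
    by (simp add: rank_in_def card_image)
qed

text \<open>Ranks depend only on the relative order of the letters. The alphabets may have different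
  types, so this is what transports series between alphabets.\<close>

lemma mono_std_map:
  fixes \<phi> :: "'i::linorder \<Rightarrow> 'j::linorder"
  assumes "strict_mono_on (mono_ind u) \<phi>"
  shows "mono_std (mono_map \<phi> u) = mono_std u"
  unfolding mono_std_eq_map mono_ind_map mono_map_comp
  by (rule mono_map_cong) (simp add: rank_in_image[OF assms])

lemma strict_mono_on_rank_in_mono_ind: "strict_mono_on (mono_ind u) (rank_in (mono_ind u))"
  by (rule strict_mono_on_rank_in) simp

lemma mono_std_idem [simp]: "mono_std (mono_std u) = mono_std u"
  unfolding mono_std_eq_map[of u]
  by (subst mono_std_map[OF strict_mono_on_rank_in_mono_ind]) (rule mono_std_eq_map)

lemma mono_std_eq_one_iff [simp]: "mono_std u = mono_one \<longleftrightarrow> u = mono_one"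
  unfolding mono_std_eq_map by simp

lemma mono_bidegree_map:
  assumes "inj_on \<phi> (mono_ind u)"
  shows "mono_bidegree (mono_map \<phi> u) = mono_bidegree u"
proof -
  have "inj_on \<phi> (fset (fst u))"
    using assms by (rule inj_on_subset) (auto simp: mono_ind_def)
  then show ?thesis
    by (simp add: mono_bidegree_def mono_map_def fcard.rep_eq card_image)
qed

lemma mono_bidegree_std [simp]: "mono_bidegree (mono_std u) = mono_bidegree u"
  unfolding mono_std_eq_map
  by (intro mono_bidegree_map strict_mono_on_imp_inj_on strict_mono_on_rank_in_mono_ind)

lemma mono_degree_eq_bidegree: "mono_degree u = snd (mono_bidegree u) + fst (mono_bidegree u)"
  by (simp add: mono_degree_def mono_bidegree_def)

lemma mono_degree_std [simp]: "mono_degree (mono_std u) = mono_degree u"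
  by (simp add: mono_degree_eq_bidegree)

lemma mono_bidegree_eq_0_iff: "mono_bidegree u = 0 \<longleftrightarrow> u = mono_one"
  by (cases u) (auto simp: mono_bidegree_def zero_prod_def fcard_0_eq)

text \<open>Factors of a monomial use only its letters, so \<open>inv_into\<close> undoes the
  relabelling on every factor, and injectivity on the letters of \<open>w\<close> is enough.\<close>

lemma sum_factorizations_map:
  assumes inj: "inj_on \<phi> (mono_ind w)"
  shows "(\<Sum>(u, v)\<in>factorizations (mono_map \<phi> w). h u v) =
         (\<Sum>(u, v)\<in>factorizations w. h (mono_map \<phi> u) (mono_map \<phi> v))"
proof -
  let ?\<psi> = "inv_into (mono_ind w) \<phi>"
  have 1: "mono_map ?\<psi> (mono_map \<phi> u) = u" if "mono_ind u \<subseteq> mono_ind w" for u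
    unfolding mono_map_comp by (rule mono_map_ident) (use that inj in auto)
  have 2: "mono_map \<phi> (mono_map ?\<psi> u) = u" if "mono_ind u \<subseteq> \<phi> ` mono_ind w" for u
    unfolding mono_map_comp by (rule mono_map_ident) (use that in \<open>auto simp: f_inv_into_f subset_iff\<close>)
  let ?G = "map_prod (mono_map \<phi>) (mono_map \<phi>)"
  have ind: "mono_ind u \<subseteq> mono_ind w \<and> mono_ind v \<subseteq> mono_ind w" if "mono_mult u v = w" for u v
    using that by (auto simp: mono_ind_mult)
  have "inj_on ?G (factorizations w)"
    by (rule inj_on_inverseI[where g = "map_prod (mono_map ?\<psi>) (mono_map ?\<psi>)"])
      (use 1 ind in \<open>auto simp del: split_paired_All\<close>)
  moreover have "?G ` factorizations w = factorizations (mono_map \<phi> w)"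
  proof (intro equalityI subsetI)
    fix z assume "z \<in> factorizations (mono_map \<phi> w)"
    then obtain u v where z: "z = (u, v)" and uv: "mono_mult u v = mono_map \<phi> w"
      by blast
    then have "mono_ind u \<union> mono_ind v = \<phi> ` mono_ind w"
      by (metis mono_ind_map mono_ind_mult)
    then have "z = ?G (mono_map ?\<psi> u, mono_map ?\<psi> v)"
      using z 2[of u] 2[of v] by (metis Un_upper1 Un_upper2 map_prod_simp)
    moreover have "mono_mult (mono_map ?\<psi> u) (mono_map ?\<psi> v) = w"
      by (simp only: mono_map_mult[symmetric] uv) (simp add: 1)
    ultimately show "z \<in> ?G ` factorizations w"
      by blast
  qed (auto simp: mono_map_mult)
  ultimately show ?thesis
    using sum.reindex[of ?G "factorizations w" "\<lambda>(u, v). h u v"] by (simp add: split_beta comp_def)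
qed

lemma finter_eq_empty_iff: "C |\<inter>| D = {||} \<longleftrightarrow> fset C \<inter> fset D = {}"
  by (simp add: fset_eq_iff set_eq_iff)

text \<open>Inversions compare a letter of \<open>u\<close> with a letter of \<open>v\<close>, hence
  monotonicity on the union of the two index sets and not merely on each of them.\<close>

lemma mono_sign_map:
  fixes \<phi> :: "'i::linorder \<Rightarrow> 'j::linorder"
  assumes \<phi>: "strict_mono_on (mono_ind u \<union> mono_ind v) \<phi>"
  shows "mono_sign (mono_map \<phi> u) (mono_map \<phi> v) = mono_sign u v"
proof -
  let ?J = "mono_ind u \<union> mono_ind v"
  have inj: "inj_on \<phi> ?J"
    using \<phi> by (rule strict_mono_on_imp_inj_on)
  have sub: "fset (fst u) \<subseteq> ?J" "fset (fst v) \<subseteq> ?J"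
    by (auto simp: mono_ind_def)
  have "\<phi> ` fset (fst u) \<inter> \<phi> ` fset (fst v) = \<phi> ` (fset (fst u) \<inter> fset (fst v))"
    using inj sub by (auto simp: inj_on_def) blast+
  then have disj: "\<phi> |`| fst u |\<inter>| \<phi> |`| fst v = {||} \<longleftrightarrow> fst u |\<inter>| fst v = {||}"
    by (simp add: finter_eq_empty_iff)
  have "{(a, b). a |\<in>| \<phi> |`| fst u \<and> b |\<in>| \<phi> |`| fst v \<and> b < a} =
      map_prod \<phi> \<phi> ` {(a, b). a |\<in>| fst u \<and> b |\<in>| fst v \<and> b < a}"
    using strict_mono_on_less[OF \<phi>] sub by (auto simp: image_iff subset_iff)
  moreover have "inj_on (map_prod \<phi> \<phi>) {(a, b). a |\<in>| fst u \<and> b |\<in>| fst v \<and> b < a}"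
    by (rule inj_on_subset[OF map_prod_inj_on[OF inj inj]]) (use sub in auto)
  ultimately show ?thesis
    by (simp add: mono_sign_def mono_map_def disj card_image)
qed

section \<open>Signs of products and associativity\<close>

definition inversions :: "'i::linorder fset \<Rightarrow> 'i fset \<Rightarrow> ('i \<times> 'i) set" where
  "inversions A B = {(a, b). a |\<in>| A \<and> b |\<in>| B \<and> b < a}"

lemma finite_inversions [simp]: "finite (inversions A B)"
  by (rule finite_subset[of _ "fset A \<times> fset B"]) (auto simp: inversions_def)

lemma mono_sign_inversions:
  "mono_sign u v = (if fst u |\<inter>| fst v = {||} then (-1) ^ card (inversions (fst u) (fst v)) else 0)"
  by (simp add: mono_sign_def inversions_def)

lemma card_inversions_union_left:
  "A |\<inter>| B = {||} \<Longrightarrow> card (inversions (A |\<union>| B) C) = card (inversions A C) + card (inversions B C)"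
proof -
  assume "A |\<inter>| B = {||}"
  then have "inversions A C \<inter> inversions B C = {}"
    by (auto simp: inversions_def fset_eq_iff)
  moreover have "inversions (A |\<union>| B) C = inversions A C \<union> inversions B C"
    by (auto simp: inversions_def)
  ultimately show ?thesis
    by (simp add: card_Un_disjoint)
qed

lemma card_inversions_union_right:
  "B |\<inter>| C = {||} \<Longrightarrow> card (inversions A (B |\<union>| C)) = card (inversions A B) + card (inversions A C)"
proof -
  assume "B |\<inter>| C = {||}"
  then have "inversions A B \<inter> inversions A C = {}"
    by (auto simp: inversions_def fset_eq_iff)
  moreover have "inversions A (B |\<union>| C) = inversions A B \<union> inversions A C"
    by (auto simp: inversions_def)
  ultimately show ?thesis
    by (simp add: card_Un_disjoint)
qed

text \<open>If the three sets of anticommuting variables are pairwise disjoint, both exponents add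
  up the inversions of the pairs \<open>(u, v)\<close>, \<open>(u, w)\<close>,
  \<open>(v, w)\<close>; otherwise a variable is repeated and both sides vanish. This is the sign
  part of associativity.\<close>

lemma mono_sign_cocycle:
  "mono_sign u v * mono_sign (mono_mult u v) w = mono_sign v w * mono_sign u (mono_mult v w)"
proof (cases "fst u |\<inter>| fst v = {||} \<and> fst u |\<inter>| fst w = {||} \<and> fst v |\<inter>| fst w = {||}")
  case True
  then have "(fst u |\<union>| fst v) |\<inter>| fst w = {||}" "fst u |\<inter>| (fst v |\<union>| fst w) = {||}"
    by (simp_all add: finter_funion_distrib finter_funion_distrib2)
  with True show ?thesis
    by (simp add: mono_sign_inversions mono_mult_def card_inversions_union_left
        card_inversions_union_right power_add)
next
  case False
  then show ?thesis
    by (auto simp: mono_sign_inversions mono_mult_def finter_funion_distrib finter_funion_distrib2)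
qed

lemma mono_mult_one [simp]: "mono_mult mono_one u = u" "mono_mult u mono_one = u"
  by (simp_all add: mono_mult_def)

lemma mono_sign_one [simp]: "mono_sign mono_one u = 1" "mono_sign u mono_one = 1"
  by (simp_all add: mono_sign_def)

lemma mono_mult_eq_one_iff: "mono_mult u v = mono_one \<longleftrightarrow> u = mono_one \<and> v = mono_one"
  by (cases u; cases v) (auto simp: mono_mult_def)

text \<open>A nonzero sign means disjoint sets of anticommuting variables. Without it the union in
  \<open>mono_mult\<close> would absorb a repeated variable and lose degree.\<close>

lemma mono_bidegree_mult:
  "mono_sign u v \<noteq> 0 \<Longrightarrow> mono_bidegree (mono_mult u v) = mono_bidegree u + mono_bidegree v"
  by (auto simp: mono_sign_def mono_bidegree_def mono_mult_def fcard_funion_disjoint split: if_splits)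

text \<open>Both sides run over the ordered factorizations of \<open>z\<close> into three
  monomials.\<close>

lemma sum_factorizations_assoc:
  "(\<Sum>(p, w)\<in>factorizations z. \<Sum>(u, v)\<in>factorizations p. H u v w) =
   (\<Sum>(u, q)\<in>factorizations z. \<Sum>(v, w)\<in>factorizations q. H u v w)" (is "?L = ?R")
proof -
  have "?L = (\<Sum>((p, w), (u, v))\<in>Sigma (factorizations z) (\<lambda>(p, w). factorizations p). H u v w)"
    by (subst sum.Sigma[symmetric])
      (auto simp: finite_mono_factorizations split_beta intro!: sum.cong)
  also have "\<dots> = (\<Sum>((u, q), (v, w))\<in>Sigma (factorizations z) (\<lambda>(u, q). factorizations q). H u v w)"
    by (rule sum.reindex_bij_witness[of _ "\<lambda>((u, q), (v, w)). ((mono_mult u v, w), (u, v))"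
          "\<lambda>((p, w), (u, v)). ((u, mono_mult v w), (v, w))"]) (auto simp: mono_mult_def sup_assoc)
  also have "\<dots> = ?R"
    by (subst sum.Sigma[symmetric])
      (auto simp: finite_mono_factorizations split_beta intro!: sum.cong)
  finally show ?thesis .
qed

lemma series_mult_assoc: "series_mult (series_mult f g) h = series_mult f (series_mult g h)"
proof
  fix z
  have "series_mult (series_mult f g) h z =
      (\<Sum>(p, w)\<in>factorizations z. \<Sum>(u, v)\<in>factorizations p.
         mono_sign u v * mono_sign (mono_mult u v) w * f u * g v * h w)"
    by (auto simp: series_mult_def sum_distrib_left sum_distrib_right algebra_simps split_beta
        intro!: sum.cong)
  also have "\<dots> = (\<Sum>(u, q)\<in>factorizations z. \<Sum>(v, w)\<in>factorizations q.
         mono_sign u v * mono_sign (mono_mult u v) w * f u * g v * h w)"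
    by (rule sum_factorizations_assoc)
  also have "\<dots> = series_mult f (series_mult g h) z"
    by (auto simp: series_mult_def sum_distrib_left sum_distrib_right mono_sign_cocycle algebra_simps
        split_beta intro!: sum.cong)
  finally show "series_mult (series_mult f g) h z = series_mult f (series_mult g h) z" .
qed

lemma sum_single:
  assumes "finite S" "x \<in> S" "\<And>y. y \<in> S \<Longrightarrow> y \<noteq> x \<Longrightarrow> h y = 0"
  shows "sum h S = h x"
  using assms by (subst sum.mono_neutral_right[of S "{x}"]) auto

lemma series_mult_one_left: "series_mult series_one f = f"
proof
  fix w
  show "series_mult series_one f w = f w"
    unfolding series_mult_def
    by (subst sum_single[of _ "(mono_one, w)"])
      (auto simp: finite_mono_factorizations series_one_def split: if_splits)
qed

lemma series_mult_one_right: "series_mult f series_one = f"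
proof
  fix w
  show "series_mult f series_one w = f w"
    unfolding series_mult_def
    by (subst sum_single[of _ "(w, mono_one)"])
      (auto simp: finite_mono_factorizations series_one_def split: if_splits)
qed

lemma bilinear_on_series_mult: "bilinear_on V W series_mult"
  unfolding bilinear_on_def
  by (intro conjI ballI linear_onI_fscale)
    (auto simp: series_mult_def plus_fun_def fscale_def algebra_simps split_beta sum.distrib
      sum_distrib_left)

lemma counit_mult: "counit (series_mult f g) = counit f * counit g"
proof -
  have "factorizations (mono_one :: nat mono) = {(mono_one, mono_one)}"
    by (auto simp: mono_mult_eq_one_iff)
  then show ?thesis
    by (simp add: counit_def series_mult_def)
qed

lemma series_mult_eq_0_or_bidegree:
  assumes "series_mult f g w \<noteq> 0"
  obtains u v where "f u \<noteq> 0" "g v \<noteq> 0" "mono_bidegree w = mono_bidegree u + mono_bidegree v"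
proof -
  from assms obtain u v where "mono_mult u v = w" "mono_sign u v * f u * g v \<noteq> 0"
    unfolding series_mult_def by (force elim!: sum.not_neutral_contains_not_neutral)
  with that[of u v] mono_bidegree_mult[of u v] show ?thesis
    by auto
qed

section \<open>Set supercompositions and the monomial basis\<close>

lemma rank_in_image_eq:
  assumes "finite J"
  shows "rank_in J ` J = {..<card J}"
proof (rule card_subset_eq)
  show "rank_in J ` J \<subseteq> {..<card J}"
    using assms by (auto simp: rank_in_def intro!: psubset_card_mono)
  show "card (rank_in J ` J) = card {..<card J}"
    using strict_mono_on_imp_inj_on[OF strict_mono_on_rank_in[OF assms]] by (simp add: card_image)
qed simp

lemma mono_ind_std: "mono_ind (mono_std u) = {..<card (mono_ind u)}"
  by (simp add: mono_std_eq_map mono_ind_map rank_in_image_eq)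

lemma length_snd_std [simp]: "length (snd (mono_std u)) = length (snd u)"
  by (simp add: mono_std_def)

lemma length_mono_supercomp [simp]: "length (mono_supercomp u) = card (mono_ind u)"
  by (simp add: mono_supercomp_def)

lemma mem_mono_supercomp_nth:
  assumes "r < card (mono_ind u)"
  shows "t \<in> mono_supercomp u ! r \<longleftrightarrow>
    (if t = 0 then r |\<in>| fst (mono_std u)
     else t \<le> length (snd u) \<and> snd (mono_std u) ! (t - 1) = r)"
  using assms by (auto simp: mono_supercomp_def)

lemma set_supercomposition_mono_supercomp:
  "set_supercomposition (length (snd u)) (fcard (fst u)) (mono_supercomp u)"
proof -
  let ?k = "card (mono_ind u)" and ?I = "mono_supercomp u"
  have snd_less: "snd (mono_std u) ! i < ?k" if "i < length (snd u)" for i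
  proof -
    have "snd (mono_std u) ! i \<in> mono_ind (mono_std u)"
      using that by (simp add: mono_ind_def)
    then show ?thesis
      by (simp add: mono_ind_std)
  qed
  have fst_less: "r < ?k" if "r |\<in>| fst (mono_std u)" for r
  proof -
    have "r \<in> mono_ind (mono_std u)"
      using that by (simp add: mono_ind_def)
    then show ?thesis
      by (simp add: mono_ind_std)
  qed
  \<comment> \<open>The letters of a standardized monomial fill the whole initial segment below
    \<open>?k\<close>, so every index occurs either among the anticommuting variables or in the
    word.\<close>
  have "?I ! r \<noteq> {}" if r: "r < ?k" for r
  proof -
    from r have "r \<in> mono_ind (mono_std u)"
      by (simp add: mono_ind_std)
    then consider "r |\<in>| fst (mono_std u)" | i where "i < length (snd u)" "snd (mono_std u) ! i = r"
      by (auto simp: mono_ind_def in_set_conv_nth)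
    then show ?thesis
    proof cases
      case 1
      with r have "0 \<in> ?I ! r"
        by (simp add: mem_mono_supercomp_nth)
      then show ?thesis by blast
    next
      case 2
      with r have "Suc i \<in> ?I ! r"
        by (simp add: mem_mono_supercomp_nth)
      then show ?thesis by blast
    qed
  qed
  moreover have "?I ! r \<subseteq> {0..length (snd u)}" if "r < ?k" for r
    using that by (auto simp: mem_mono_supercomp_nth split: if_splits)
  moreover have "?I ! r \<inter> ?I ! s \<subseteq> {0}" if "r < ?k" "s < ?k" "r \<noteq> s" for r s
    using that by (auto simp: mem_mono_supercomp_nth split: if_splits)
  moreover have "(\<Union>r<?k. ?I ! r - {0}) = {1..length (snd u)}"
  proof (intro equalityI subsetI)
    fix t assume "t \<in> {1..length (snd u)}"
    moreover from this have "snd (mono_std u) ! (t - 1) < ?k"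
      by (intro snd_less) auto
    ultimately have "t \<in> ?I ! (snd (mono_std u) ! (t - 1)) - {0}" "snd (mono_std u) ! (t - 1) < ?k"
      by (auto simp: mem_mono_supercomp_nth)
    then show "t \<in> (\<Union>r<?k. ?I ! r - {0})"
      by blast
  qed (auto simp: mem_mono_supercomp_nth)
  moreover have "card {r. r < ?k \<and> 0 \<in> ?I ! r} = fcard (fst u)"
  proof -
    have "{r. r < ?k \<and> 0 \<in> ?I ! r} = fset (fst (mono_std u))"
      using fst_less by (auto simp: mem_mono_supercomp_nth)
    then show ?thesis
      using mono_bidegree_std[of u] by (simp add: mono_bidegree_def fcard.rep_eq)
  qed
  ultimately show ?thesis
    unfolding set_supercomposition_def length_mono_supercomp by blast
qed

lemma set_supercomposition_unique:
  assumes "set_supercomposition n m I" "set_supercomposition n' m' I"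
  shows "n = n'" "m = m'"
proof -
  have "{1..n} = {1..n'}"
    using assms unfolding set_supercomposition_def by metis
  then show "n = n'"
    by (metis card_atLeastAtMost diff_Suc_1)
  show "m = m'"
    using assms unfolding set_supercomposition_def by metis
qed

text \<open>The set supercomposition encodes the standardization: the block containing
  \<open>t\<close> names the \<open>t\<close>-th letter of the word, and the blocks containing
  \<open>0\<close> name the anticommuting variables. Hence each \<open>M (mono_supercomp u)\<close>
  is the indicator function of a standardization class.\<close>

lemma mono_supercomp_eq_iff: "mono_supercomp u = mono_supercomp v \<longleftrightarrow> mono_std u = mono_std v"
proof
  assume std: "mono_std u = mono_std v"
  have "length (snd u) = length (snd v)"
    using arg_cong[OF std, of "\<lambda>w. length (snd w)"] by simp
  moreover have "card (mono_ind u) = card (mono_ind v)"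
    using arg_cong[OF std, of "\<lambda>w. card (mono_ind w)"] by (simp add: mono_ind_std)
  ultimately show "mono_supercomp u = mono_supercomp v"
    unfolding mono_supercomp_def std by simp
next
  assume eq: "mono_supercomp u = mono_supercomp v"
  have k: "card (mono_ind u) = card (mono_ind v)"
    using arg_cong[OF eq, of length] by simp
  have len: "length (snd u) = length (snd v)"
    using set_supercomposition_mono_supercomp[of u] set_supercomposition_mono_supercomp[of v]
    unfolding eq by (rule set_supercomposition_unique)
  have less: "r < card (mono_ind u)" if "r \<in> mono_ind (mono_std u)" for r
    using that by (simp add: mono_ind_std)
  have less': "r < card (mono_ind v)" if "r \<in> mono_ind (mono_std v)" for r
    using that by (simp add: mono_ind_std)
  show "mono_std u = mono_std v"
  proof (rule prod_eqI)
    have "r |\<in>| fst (mono_std u) \<longleftrightarrow> r < card (mono_ind u) \<and> 0 \<in> mono_supercomp u ! r" for r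
      using less[of r] by (auto simp: mem_mono_supercomp_nth mono_ind_def)
    moreover have "r |\<in>| fst (mono_std v) \<longleftrightarrow> r < card (mono_ind v) \<and> 0 \<in> mono_supercomp v ! r" for r
      using less'[of r] by (auto simp: mem_mono_supercomp_nth mono_ind_def)
    ultimately show "fst (mono_std u) = fst (mono_std v)"
      by (simp add: fset_eq_iff eq k)
    show "snd (mono_std u) = snd (mono_std v)"
    proof (rule nth_equalityI)
      fix i assume i: "i < length (snd (mono_std u))"
      let ?r = "snd (mono_std u) ! i"
      have r: "?r < card (mono_ind u)"
        using i nth_mem[OF i] by (intro less) (simp add: mono_ind_def)
      \<comment> \<open>Positions in blocks count from 1, list entries from 0.\<close>
      then have "Suc i \<in> mono_supercomp u ! ?r"
        using i by (simp add: mem_mono_supercomp_nth)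
      then show "?r = snd (mono_std v) ! i"
        using r unfolding eq k by (simp add: mem_mono_supercomp_nth)
    qed (simp add: len)
  qed
qed

lemma mono_supercomp_std [simp]: "mono_supercomp (mono_std u) = mono_supercomp u"
  by (simp add: mono_supercomp_eq_iff)

lemma set_supercomposition_bidegree:
  "set_supercomposition n m (mono_supercomp u) \<Longrightarrow> mono_bidegree u = (n, m)"
  unfolding mono_bidegree_def
  using set_supercomposition_mono_supercomp[of u] by (auto dest: set_supercomposition_unique)


section \<open>Series invariant under standardization\<close>

lemma M_mono_supercomp: "M (mono_supercomp a) u = (if mono_std u = mono_std a then 1 else 0)"
  by (simp add: M_def mono_supercomp_eq_iff)

lemma sNCQSym_std: "f \<in> sNCQSym \<Longrightarrow> f (mono_std u) = f u"
  unfolding sNCQSym_def using mono_std_idem by blast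

lemma sNCQSym_iff: "f \<in> sNCQSym \<longleftrightarrow> bounded_degree f \<and> (\<forall>u. f (mono_std u) = f u)"
  unfolding sNCQSym_def mem_Collect_eq by (metis mono_std_idem)

lemma sNCQSym_bounded:
  assumes "f \<in> sNCQSym"
  obtains d where "\<And>u. f u \<noteq> 0 \<Longrightarrow> mono_degree u \<le> d"
  using assms unfolding sNCQSym_def bounded_degree_def by blast

lemma subspace_sNCQSym: "fun_space.subspace sNCQSym"
proof (rule fun_space.subspaceI)
  show "0 \<in> sNCQSym"
    by (simp add: sNCQSym_iff bounded_degree_def)
next
  fix f g assume f: "f \<in> sNCQSym" and g: "g \<in> sNCQSym"
  obtain d where d: "\<And>u. f u \<noteq> 0 \<Longrightarrow> mono_degree u \<le> d"
    using sNCQSym_bounded[OF f] by metis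
  obtain e where e: "\<And>u. g u \<noteq> 0 \<Longrightarrow> mono_degree u \<le> e"
    using sNCQSym_bounded[OF g] by metis
  have "mono_degree u \<le> max d e" if "(f + g) u \<noteq> 0" for u
  proof -
    from that have "f u \<noteq> 0 \<or> g u \<noteq> 0"
      by auto
    then show ?thesis
      using d[of u] e[of u] by auto
  qed
  then show "f + g \<in> sNCQSym"
    using f g unfolding sNCQSym_iff bounded_degree_def by (metis plus_fun_apply)
next
  fix c f assume "f \<in> sNCQSym"
  then show "fscale c f \<in> sNCQSym"
    unfolding sNCQSym_iff bounded_degree_def fscale_def by (metis mult_zero_right)
qed

lemma M_in_sNCQSym:
  assumes "set_supercomposition n m I"
  shows "M I \<in> sNCQSym"
proof -
  have "mono_degree u \<le> n + m" if "M I u \<noteq> 0" for u :: "nat mono"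
    using that assms by (auto simp: M_def mono_degree_eq_bidegree dest: set_supercomposition_bidegree split: if_splits)
  then show ?thesis
    by (auto simp: sNCQSym_iff bounded_degree_def) (auto simp: M_def)
qed

text \<open>A function constant on the fibres of \<open>\<kappa>\<close> is a combination of their
  indicator functions. The coefficient is written with the same \<open>SOME\<close> as in
  \<open>coproduct\<close>, so the expansion matches that definition literally; a general
  \<open>\<kappa>\<close> covers pairs of monomials too.\<close>

lemma class_function_expansion:
  fixes f :: "'m \<Rightarrow> 'k::field"
  assumes fin: "finite (\<kappa> ` {u. f u \<noteq> 0})"
    and inv: "\<And>u v. \<kappa> u = \<kappa> v \<Longrightarrow> f u = f v"
  shows "f u = (\<Sum>k\<in>\<kappa> ` {u. f u \<noteq> 0}. f (SOME v. \<kappa> v = k) * (if \<kappa> u = k then 1 else 0))"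
proof -
  have "f (SOME v. \<kappa> v = \<kappa> u) = f u"
    by (rule inv) (rule someI, rule refl)
  then have "f u = (if \<kappa> u \<in> \<kappa> ` {u. f u \<noteq> 0} then f (SOME v. \<kappa> v = \<kappa> u) else 0)"
    by (metis (mono_tags, lifting) image_eqI mem_Collect_eq)
  also have "\<dots> = (\<Sum>k\<in>\<kappa> ` {u. f u \<noteq> 0}. f (SOME v. \<kappa> v = k) * (if \<kappa> u = k then 1 else 0))"
    using fin by (simp add: if_distrib[of "(*) _"] sum.delta' cong: if_cong)
  finally show ?thesis .
qed

lemma subspace_support:
  fixes V :: "('a \<Rightarrow> 'b::field) set"
  assumes "fun_space.subspace V"
  shows "fun_space.subspace {f \<in> V. \<forall>u. f u \<noteq> 0 \<longrightarrow> Q u}"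
proof (rule fun_space.subspaceI)
  show "0 \<in> {f \<in> V. \<forall>u. f u \<noteq> 0 \<longrightarrow> Q u}"
    using fun_space.subspace_0[OF assms] by simp
next
  fix f g assume "f \<in> {f \<in> V. \<forall>u. f u \<noteq> 0 \<longrightarrow> Q u}" "g \<in> {f \<in> V. \<forall>u. f u \<noteq> 0 \<longrightarrow> Q u}"
  moreover from this have "f + g \<in> V"
    by (intro fun_space.subspace_add[OF assms]) auto
  moreover have "f u \<noteq> 0 \<or> g u \<noteq> 0" if "(f + g) u \<noteq> 0" for u
    using that by auto
  ultimately show "f + g \<in> {f \<in> V. \<forall>u. f u \<noteq> 0 \<longrightarrow> Q u}"
    by blast
next
  fix c f assume f: "f \<in> {f \<in> V. \<forall>u. f u \<noteq> 0 \<longrightarrow> Q u}"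
  then have "fscale c f \<in> V"
    by (intro fun_space.subspace_scale[OF assms]) auto
  with f show "fscale c f \<in> {f \<in> V. \<forall>u. f u \<noteq> 0 \<longrightarrow> Q u}"
    by (auto simp: fscale_def)
qed

text \<open>Turns the spans that define parity and bidegree into support conditions, which every
  later homogeneity argument uses. The predicate \<open>Q\<close> selects either grading.\<close>

lemma span_M_eq:
  "fun_space.span {M I |I n m. set_supercomposition n m I \<and> Q (n, m)} =
   {f \<in> sNCQSym. \<forall>u. f u \<noteq> 0 \<longrightarrow> Q (mono_bidegree u)}" (is "fun_space.span ?B = ?V")
proof (rule antisym)
  show "fun_space.span ?B \<subseteq> ?V"
  proof (rule fun_space.span_minimal)
    show "fun_space.subspace ?V"
      by (rule subspace_support[OF subspace_sNCQSym])
    show "?B \<subseteq> ?V"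
      by (auto simp: M_in_sNCQSym) (auto simp: M_def dest: set_supercomposition_bidegree split: if_splits)
  qed
next
  show "?V \<subseteq> fun_space.span ?B"
  proof
    fix f assume f: "f \<in> ?V"
    then have inv: "f u = f v" if "mono_supercomp u = mono_supercomp v" for u v
      using that unfolding mono_supercomp_eq_iff sNCQSym_def by blast
    have fin: "finite (mono_supercomp ` {u. f u \<noteq> 0})"
      by (rule finite_supercomp_support) (use f in blast)
    have "f = (\<Sum>I\<in>mono_supercomp ` {u. f u \<noteq> 0}. fscale (f (SOME v. mono_supercomp v = I)) (M I))"
    proof
      fix u
      show "f u = (\<Sum>I\<in>mono_supercomp ` {u. f u \<noteq> 0}. fscale (f (SOME v. mono_supercomp v = I)) (M I)) u"
        unfolding sum_fun_apply fscale_def M_def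
        using fin inv by (rule class_function_expansion)
    qed
    also have "\<dots> \<in> fun_space.span ?B"
    proof (intro fun_space.span_sum fun_space.span_scale fun_space.span_base)
      fix I assume "I \<in> mono_supercomp ` {u. f u \<noteq> 0}"
      then obtain u where "f u \<noteq> 0" and I: "I = mono_supercomp u"
        by blast
      with f have "Q (length (snd u), fcard (fst u))"
        by (auto simp: mono_bidegree_def)
      then show "M I \<in> ?B"
        unfolding I using set_supercomposition_mono_supercomp by blast
    qed
    finally show "f \<in> fun_space.span ?B" .
  qed
qed

lemma sNCQSym_bidegree_eq:
  "sNCQSym_bidegree a = {f \<in> sNCQSym. \<forall>u. f u \<noteq> 0 \<longrightarrow> mono_bidegree u = a}"
proof (cases a)
  case (Pair n m)
  show ?thesis
    using span_M_eq[of "\<lambda>b. b = a"] by (simp add: sNCQSym_bidegree_def Pair)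
qed

definition mono_parity :: "'i mono \<Rightarrow> bit" where
  "mono_parity u = (if even (fcard (fst u)) then 0 else 1)"

lemma mono_parity_bidegree: "mono_parity u = (if even (snd (mono_bidegree u)) then 0 else 1)"
  by (simp add: mono_parity_def mono_bidegree_def)

lemma sNCQSym_parity_eq:
  "sNCQSym_parity p = {f \<in> sNCQSym. \<forall>u. f u \<noteq> 0 \<longrightarrow> mono_parity u = p}"
  using span_M_eq[of "\<lambda>b. (if even (snd b) then 0 else 1) = p"]
  by (simp only: sNCQSym_parity_def mono_parity_bidegree snd_conv)

lemma tensor_M_apply:
  "(M I \<otimes>\<^sub>v M J) z = (if map_prod mono_supercomp mono_supercomp z = (I, J) then 1 else 0)"
  by (cases z) (simp add: tensor_def M_def)

text \<open>The degree bound leaves finitely many pairs of standardization classes, so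
  \<open>t\<close> is a finite combination of products of their indicators. Keeping only pairs with
  \<open>t (a, b) \<noteq> 0\<close> among the generators later yields the grading as well as
  membership.\<close>

lemma tensor_space_class_functions:
  fixes t :: "nat mono \<times> nat mono \<Rightarrow> rat"
  assumes inv: "\<And>u v. t (mono_std u, mono_std v) = t (u, v)"
    and bound: "\<And>u v. t (u, v) \<noteq> 0 \<Longrightarrow> mono_degree u \<le> d \<and> mono_degree v \<le> d"
  shows "t \<in> fun_space.span {M (mono_supercomp a) \<otimes>\<^sub>v M (mono_supercomp b) |a b :: nat mono. t (a, b) \<noteq> 0}"
    (is "t \<in> fun_space.span ?B")
proof -
  let ?\<kappa> = "map_prod mono_supercomp mono_supercomp :: nat mono \<times> nat mono \<Rightarrow> _"
  \<comment> \<open>This series has all monomials of degree at most \<open>d\<close> as its support,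
    so the finiteness already known for supports in \<open>sNCQSym\<close> applies to the whole
    range of degrees.\<close>
  let ?e = "(\<lambda>u. if mono_degree u \<le> d then 1 else 0) :: nat series"
  have "?e \<in> sNCQSym"
    by (auto simp: sNCQSym_iff bounded_degree_def)
  then have "finite (mono_supercomp ` {u. ?e u \<noteq> 0})"
    by (rule finite_supercomp_support)
  moreover have "{u. ?e u \<noteq> 0} = {u. mono_degree u \<le> d}"
    by auto
  ultimately have fin_e: "finite (mono_supercomp ` {u :: nat mono. mono_degree u \<le> d})"
    by simp
  have fin: "finite (?\<kappa> ` {z. t z \<noteq> 0})"
    by (rule finite_subset[OF _ finite_cartesian_product[OF fin_e fin_e]]) (use bound in force)
  have "t = (\<Sum>k\<in>?\<kappa> ` {z. t z \<noteq> 0}. fscale (t (SOME z. ?\<kappa> z = k)) (M (fst k) \<otimes>\<^sub>v M (snd k)))"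
  proof
    fix z
    have "t x = t y" if "?\<kappa> x = ?\<kappa> y" for x y
    proof -
      have "mono_std (fst x) = mono_std (fst y)" "mono_std (snd x) = mono_std (snd y)"
        using that by (auto simp: mono_supercomp_eq_iff[symmetric] map_prod_def split_beta)
      then show ?thesis
        using inv[of "fst x" "snd x"] inv[of "fst y" "snd y"] by simp
    qed
    from class_function_expansion[of ?\<kappa> t, OF fin this, of z]
    show "t z = (\<Sum>k\<in>?\<kappa> ` {z. t z \<noteq> 0}. fscale (t (SOME z. ?\<kappa> z = k)) (M (fst k) \<otimes>\<^sub>v M (snd k))) z"
      by (simp only: sum_fun_apply fscale_def tensor_M_apply prod.collapse)
  qed
  also have "\<dots> \<in> fun_space.span ?B"
  proof (intro fun_space.span_sum fun_space.span_scale fun_space.span_base)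
    fix k assume "k \<in> ?\<kappa> ` {z. t z \<noteq> 0}"
    then obtain z where "t z \<noteq> 0" "k = ?\<kappa> z"
      by (elim imageE CollectE)
    then have "t (fst z, snd z) \<noteq> 0" "M (fst k) \<otimes>\<^sub>v M (snd k) = M (mono_supercomp (fst z)) \<otimes>\<^sub>v M (mono_supercomp (snd z))"
      by (simp_all only: prod.collapse fst_map_prod snd_map_prod not_False_eq_True)
    then show "M (fst k) \<otimes>\<^sub>v M (snd k) \<in> ?B"
      by blast
  qed
  finally show ?thesis .
qed

section \<open>Splitting alphabets\<close>

lemma sum_less_simps [simp]:
  "Inl a < (Inl b :: 'a::linorder + 'b::linorder) \<longleftrightarrow> a < b"
  "Inr c < (Inr d :: 'a::linorder + 'b::linorder) \<longleftrightarrow> c < d"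
  "Inl a < (Inr d :: 'a::linorder + 'b::linorder)"
  "\<not> Inr c < (Inl b :: 'a::linorder + 'b::linorder)"
  by (auto simp: less_sum_def less_eq_sum_def)

lemma fst_mono_split:
  "fst (fst (mono_split z)) = projl |`| ffilter isl (fst z)"
  "fst (snd (mono_split z)) = projr |`| ffilter (\<lambda>a. \<not> isl a) (fst z)"
  by (simp_all add: mono_split_def)

lemma snd_mono_split:
  "snd (fst (mono_split z)) = map projl (filter isl (snd z))"
  "snd (snd (mono_split z)) = map projr (filter (\<lambda>a. \<not> isl a) (snd z))"
  by (simp_all add: mono_split_def)

lemma mem_projl_ffilter: "a |\<in>| projl |`| ffilter isl A \<longleftrightarrow> Inl a |\<in>| A"
  by (force simp: fimage_iff)

lemma mem_projr_ffilter: "b |\<in>| projr |`| ffilter (\<lambda>a. \<not> isl a) A \<longleftrightarrow> Inr b |\<in>| A"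
proof
  assume "b |\<in>| projr |`| ffilter (\<lambda>a. \<not> isl a) A"
  then obtain x where "x |\<in>| A" "\<not> isl x" "b = projr x"
    by auto
  then show "Inr b |\<in>| A"
    by (cases x) auto
qed (force simp: fimage_iff)

lemma mem_fst_mono_split:
  "a |\<in>| fst (fst (mono_split z)) \<longleftrightarrow> Inl a |\<in>| fst z"
  "b |\<in>| fst (snd (mono_split z)) \<longleftrightarrow> Inr b |\<in>| fst z"
  unfolding fst_mono_split by (rule mem_projl_ffilter, rule mem_projr_ffilter)

lemma set_map_projl: "a \<in> set (map projl (filter isl xs)) \<longleftrightarrow> Inl a \<in> set xs"
  by (force simp: image_iff)

lemma set_map_projr: "b \<in> set (map projr (filter (\<lambda>a. \<not> isl a) xs)) \<longleftrightarrow> Inr b \<in> set xs"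
proof -
  have "(\<exists>x. x \<in> set xs \<and> \<not> isl x \<and> b = projr x) \<longleftrightarrow> Inr b \<in> set xs"
    by (metis Inr_Inl_False isl_def sum.collapse(2) sum.sel(2))
  then show ?thesis
    by auto
qed

lemma mono_ind_split_left: "mono_ind (fst (mono_split z)) = {a. Inl a \<in> mono_ind z}"
  unfolding mono_ind_def snd_mono_split by (auto simp: mem_fst_mono_split set_map_projl simp del: set_map)

lemma mono_ind_split_right: "mono_ind (snd (mono_split z)) = {b. Inr b \<in> mono_ind z}"
  unfolding mono_ind_def snd_mono_split by (auto simp: mem_fst_mono_split set_map_projr simp del: set_map)

lemma mono_split_map:
  "mono_split (mono_map (map_sum \<phi> \<psi>) z) =
     (mono_map \<phi> (fst (mono_split z)), mono_map \<psi> (snd (mono_split z)))"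
proof (intro prod_eqI)
  have "Inl a |\<in>| map_sum \<phi> \<psi> |`| A \<longleftrightarrow> (\<exists>b. Inl b |\<in>| A \<and> a = \<phi> b)" for a A
  proof -
    have "Inl a |\<in>| map_sum \<phi> \<psi> |`| A \<longleftrightarrow> (\<exists>x. x |\<in>| A \<and> Inl a = map_sum \<phi> \<psi> x)"
      by auto
    then show ?thesis
      by (simp add: split_sum_ex)
  qed
  then show "fst (fst (mono_split (mono_map (map_sum \<phi> \<psi>) z))) =
      fst (fst (mono_map \<phi> (fst (mono_split z)), mono_map \<psi> (snd (mono_split z))))"
    by (auto simp: fset_eq_iff mem_fst_mono_split mono_map_def fimage_iff simp del: fimage_iff)
  have "Inr a |\<in>| map_sum \<phi> \<psi> |`| A \<longleftrightarrow> (\<exists>b. Inr b |\<in>| A \<and> a = \<psi> b)" for a A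
  proof -
    have "Inr a |\<in>| map_sum \<phi> \<psi> |`| A \<longleftrightarrow> (\<exists>x. x |\<in>| A \<and> Inr a = map_sum \<phi> \<psi> x)"
      by auto
    then show ?thesis
      by (simp add: split_sum_ex)
  qed
  then show "fst (snd (mono_split (mono_map (map_sum \<phi> \<psi>) z))) =
      fst (snd (mono_map \<phi> (fst (mono_split z)), mono_map \<psi> (snd (mono_split z))))"
    by (auto simp: fset_eq_iff mem_fst_mono_split mono_map_def fimage_iff simp del: fimage_iff)
  have "map projl (filter isl (map (map_sum \<phi> \<psi>) xs)) = map \<phi> (map projl (filter isl xs))"
    "map projr (filter (\<lambda>a. \<not> isl a) (map (map_sum \<phi> \<psi>) xs)) = map \<psi> (map projr (filter (\<lambda>a. \<not> isl a) xs))" for xs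
    by (induction xs) (auto split: sum.splits simp: isl_def map_sum_def)
  then show "snd (fst (mono_split (mono_map (map_sum \<phi> \<psi>) z))) =
      snd (fst (mono_map \<phi> (fst (mono_split z)), mono_map \<psi> (snd (mono_split z))))"
    "snd (snd (mono_split (mono_map (map_sum \<phi> \<psi>) z))) =
      snd (snd (mono_map \<phi> (fst (mono_split z)), mono_map \<psi> (snd (mono_split z))))"
    unfolding snd_mono_split by (simp_all add: mono_map_def snd_mono_split)
qed

lemma mono_ind_split:
  "mono_ind z = Inl ` mono_ind (fst (mono_split z)) \<union> Inr ` mono_ind (snd (mono_split z))"
proof -
  have "x \<in> Inl ` {a. Inl a \<in> X} \<union> Inr ` {b. Inr b \<in> X} \<longleftrightarrow> x \<in> X" for x and X :: "('a + 'b) set"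
    by (cases x) auto
  then show ?thesis
    unfolding mono_ind_split_left mono_ind_split_right by blast
qed

text \<open>A shuffle of \<open>u\<close> and \<open>v\<close> has exactly their letters, so
  relabelling each alphabet separately is a bijection between the two sets of shuffles.\<close>

lemma sum_split_map:
  assumes \<phi>: "inj_on \<phi> (mono_ind u)" and \<psi>: "inj_on \<psi> (mono_ind v)"
  shows "(\<Sum>z | mono_split z = (mono_map \<phi> u, mono_map \<psi> v). h z) =
         (\<Sum>z | mono_split z = (u, v). h (mono_map (map_sum \<phi> \<psi>) z))"
proof -
  let ?\<phi>' = "inv_into (mono_ind u) \<phi>" and ?\<psi>' = "inv_into (mono_ind v) \<psi>"
  let ?F = "mono_map (map_sum \<phi> \<psi>)" and ?G = "mono_map (map_sum ?\<phi>' ?\<psi>')"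
  have "?G (?F z) = z" if "mono_split z = (u, v)" for z
    unfolding mono_map_comp by (rule mono_map_ident) (use \<phi> \<psi> that in \<open>auto simp: mono_ind_split[of z]\<close>)
  moreover have "?F (?G z) = z" if "mono_split z = (mono_map \<phi> u, mono_map \<psi> v)" for z
    unfolding mono_map_comp
    by (rule mono_map_ident) (use that in \<open>auto simp: mono_ind_split[of z] mono_ind_map f_inv_into_f\<close>)
  moreover have "mono_map ?\<phi>' (mono_map \<phi> u) = u" "mono_map ?\<psi>' (mono_map \<psi> v) = v"
    unfolding mono_map_comp by (rule mono_map_ident, use \<phi> \<psi> in simp)+
  ultimately show ?thesis
    by (intro sum.reindex_bij_witness[of _ ?F ?G]) (simp_all add: mono_split_map)
qed

lemma strict_mono_on_map_sum:
  assumes "strict_mono_on A \<phi>" and "strict_mono_on B \<psi>"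
  shows "strict_mono_on (Inl ` A \<union> Inr ` B) (map_sum \<phi> \<psi>)"
  using assms by (auto simp: strict_mono_on_def)

section \<open>The coproduct as a sum over shuffles\<close>

definition std_extend :: "nat series \<Rightarrow> 'i::linorder series" where
  "std_extend f = (\<lambda>u. f (mono_std u))"

text \<open>A formula for all coefficient functions, with no sum over basis elements. Arbitrary
  alphabets are allowed because iterating the coproduct evaluates it on compound alphabets such as
  \<open>'a + 'b\<close>.\<close>

definition std_coproduct :: "nat series \<Rightarrow> 'i::linorder mono \<times> 'j::linorder mono \<Rightarrow> rat" where
  "std_coproduct f = project (std_extend f)"

lemma std_coproduct_apply: "std_coproduct f t = (\<Sum>z | mono_split z = t. f (mono_std z))"
  by (simp add: std_coproduct_def project_def std_extend_def)

lemma std_coproduct_map: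
  assumes \<phi>: "strict_mono_on (mono_ind u) \<phi>" and \<psi>: "strict_mono_on (mono_ind v) \<psi>"
  shows "std_coproduct f (mono_map \<phi> u, mono_map \<psi> v) = std_coproduct f (u, v)"
  unfolding std_coproduct_apply
    sum_split_map[OF \<phi>[THEN strict_mono_on_imp_inj_on] \<psi>[THEN strict_mono_on_imp_inj_on]]
proof (intro sum.cong refl arg_cong[where f = f] mono_std_map)
  fix z assume "z \<in> {z. mono_split z = (u, v)}"
  then show "strict_mono_on (mono_ind z) (map_sum \<phi> \<psi>)"
    using strict_mono_on_map_sum[OF \<phi> \<psi>] mono_ind_split[of z] by simp
qed

lemma strict_mono_on_id': "strict_mono_on A (\<lambda>x. x)"
  by (simp add: strict_mono_on_def)

lemma mono_map_id: "mono_map (\<lambda>x. x) u = u"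
  by (simp add: mono_map_def)

text \<open>The two sides live over different alphabets, since \<open>mono_std u\<close> always has
  letters in \<open>nat\<close>. This links a slice, which is a series over \<open>nat\<close>, to
  monomials in a compound alphabet.\<close>

lemma std_coproduct_std:
  "std_coproduct f (mono_std u, v) = std_coproduct f (u, v)"
  "std_coproduct f (u, mono_std v) = std_coproduct f (u, v)"
  using std_coproduct_map[OF strict_mono_on_rank_in_mono_ind strict_mono_on_id', of f u v]
    std_coproduct_map[OF strict_mono_on_id' strict_mono_on_rank_in_mono_ind, of f u v]
  by (simp_all add: mono_std_eq_map mono_map_id)

lemma std_coproduct_comp_std: "std_coproduct (\<lambda>a. f (mono_std a)) = std_coproduct f"
  by (simp add: std_coproduct_apply fun_eq_iff)

lemma fst_eq_split: "fst z = Inl |`| fst (fst (mono_split z)) |\<union>| Inr |`| fst (snd (mono_split z))"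
proof (rule fset_eqI)
  fix x
  show "x |\<in>| fst z \<longleftrightarrow> x |\<in>| Inl |`| fst (fst (mono_split z)) |\<union>| Inr |`| fst (snd (mono_split z))"
    by (cases x) (auto simp: mem_fst_mono_split)
qed

lemma mono_bidegree_split:
  "mono_bidegree (fst (mono_split z)) + mono_bidegree (snd (mono_split z)) = mono_bidegree z"
proof -
  have "Inl |`| A |\<inter>| Inr |`| B = {||}" for A :: "'a fset" and B :: "'b fset"
    by auto
  then have "fcard (fst (fst (mono_split z))) + fcard (fst (snd (mono_split z))) = fcard (fst z)"
    using arg_cong[OF fst_eq_split[of z], of fcard]
    by (simp add: fcard_funion_disjoint) (simp add: fcard.rep_eq card_image)
  then show ?thesis
    by (simp add: mono_bidegree_def snd_mono_split sum_length_filter_compl)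
qed

lemma mono_split_map_Inl: "mono_split (mono_map Inl u) = (u, mono_one)"
  by (intro prod_eqI fset_eqI)
    (auto simp: mem_fst_mono_split mono_map_def snd_mono_split filter_map comp_def)

lemma mono_split_map_Inr: "mono_split (mono_map Inr u) = (mono_one, u)"
  by (intro prod_eqI fset_eqI)
    (auto simp: mem_fst_mono_split mono_map_def snd_mono_split filter_map comp_def)

lemma mono_ind_one [simp]: "mono_ind mono_one = {}"
  by (simp add: mono_ind_def)

lemma mono_split_eq_one_left: "mono_split z = (mono_one, v) \<longleftrightarrow> z = mono_map Inr v"
proof
  assume z: "mono_split z = (mono_one, v)"
  have "z = mono_map Inr (mono_map projr z)"
    unfolding mono_map_comp by (rule mono_map_ident[symmetric]) (use z in \<open>auto simp: mono_ind_split[of z]\<close>)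
  then obtain y where "z = mono_map Inr y"
    by blast
  with z show "z = mono_map Inr v"
    by (simp add: mono_split_map_Inr)
qed (simp add: mono_split_map_Inr)

lemma mono_split_eq_one_right: "mono_split z = (u, mono_one) \<longleftrightarrow> z = mono_map Inl u"
proof
  assume z: "mono_split z = (u, mono_one)"
  have "z = mono_map Inl (mono_map projl z)"
    unfolding mono_map_comp by (rule mono_map_ident[symmetric]) (use z in \<open>auto simp: mono_ind_split[of z]\<close>)
  then obtain y where "z = mono_map Inl y"
    by blast
  with z show "z = mono_map Inl u"
    by (simp add: mono_split_map_Inl)
qed (simp add: mono_split_map_Inl)

lemma std_coproduct_one_left: "std_coproduct f (mono_one, v) = f (mono_std v)"
  by (simp add: std_coproduct_apply mono_split_eq_one_left mono_std_map strict_mono_on_def)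

lemma std_coproduct_one_right: "std_coproduct f (u, mono_one) = f (mono_std u)"
  by (simp add: std_coproduct_apply mono_split_eq_one_right mono_std_map strict_mono_on_def)

section \<open>Coassociativity through three alphabets\<close>

definition assoc_sum :: "('a + 'b) + 'c \<Rightarrow> 'a + ('b + 'c)" where
  "assoc_sum = case_sum (case_sum Inl (Inr \<circ> Inl)) (Inr \<circ> Inr)"

definition assoc_sum' :: "'a + ('b + 'c) \<Rightarrow> ('a + 'b) + 'c" where
  "assoc_sum' = case_sum (Inl \<circ> Inl) (case_sum (Inl \<circ> Inr) Inr)"

lemma assoc_sum_inverse: "assoc_sum (assoc_sum' x) = x" "assoc_sum' (assoc_sum y) = y"
  by (auto simp: assoc_sum_def assoc_sum'_def split: sum.splits)

lemma strict_mono_assoc_sum: "strict_mono (assoc_sum :: ('a::linorder + 'b::linorder) + 'c::linorder \<Rightarrow> _)"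
proof (rule strict_monoI)
  fix x y :: "('a + 'b) + 'c" assume "x < y"
  then show "assoc_sum x < assoc_sum y"
    by (auto simp: assoc_sum_def split: sum.splits)
qed

lemma mono_split_assoc_sum:
  "fst (mono_split (mono_map assoc_sum z)) = fst (mono_split (fst (mono_split z)))"
  "fst (mono_split (snd (mono_split (mono_map assoc_sum z)))) = snd (mono_split (fst (mono_split z)))"
  "snd (mono_split (snd (mono_split (mono_map assoc_sum z)))) = snd (mono_split z)"
proof -
  have eq: "assoc_sum x = y \<longleftrightarrow> x = assoc_sum' y" for x :: "('a + 'b) + 'c" and y
    using assoc_sum_inverse by metis
  have mem: "y |\<in>| assoc_sum |`| A \<longleftrightarrow> assoc_sum' y |\<in>| A" for y and A :: "(('a + 'b) + 'c) fset"
    using assoc_sum_inverse by (metis fimageE fimage_eqI)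
  have simps: "assoc_sum' (Inl a) = Inl (Inl a)" "assoc_sum' (Inr (Inl b)) = Inl (Inr b)"
    "assoc_sum' (Inr (Inr c)) = Inr c" for a :: 'a and b :: 'b and c :: 'c
    by (simp_all add: assoc_sum'_def)
  have 1: "map projl (filter isl (map assoc_sum xs)) = map projl (filter isl (map projl (filter isl xs)))"
    for xs :: "(('a + 'b) + 'c) list"
    by (induction xs) (auto simp: assoc_sum_def split: sum.splits)
  have 2: "map projl (filter isl (map projr (filter (\<lambda>a. \<not> isl a) (map assoc_sum xs)))) =
      map projr (filter (\<lambda>a. \<not> isl a) (map projl (filter isl xs)))"
    for xs :: "(('a + 'b) + 'c) list"
    by (induction xs) (auto simp: assoc_sum_def split: sum.splits)
  have 3: "map projr (filter (\<lambda>a. \<not> isl a) (map projr (filter (\<lambda>a. \<not> isl a) (map assoc_sum xs)))) =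
      map projr (filter (\<lambda>a. \<not> isl a) xs)"
    for xs :: "(('a + 'b) + 'c) list"
    by (induction xs) (auto simp: assoc_sum_def split: sum.splits)
  have map: "fst (mono_map assoc_sum z) = assoc_sum |`| fst z" "snd (mono_map assoc_sum z) = map assoc_sum (snd z)"
    by (simp_all add: mono_map_def)
  show "fst (mono_split (mono_map assoc_sum z)) = fst (mono_split (fst (mono_split z)))"
    by (intro prod_eqI fset_eqI) (simp_all only: mem_fst_mono_split snd_mono_split map mem simps 1)
  show "fst (mono_split (snd (mono_split (mono_map assoc_sum z)))) = snd (mono_split (fst (mono_split z)))"
    by (intro prod_eqI fset_eqI) (simp_all only: mem_fst_mono_split snd_mono_split map mem simps 2)
  show "snd (mono_split (snd (mono_split (mono_map assoc_sum z)))) = snd (mono_split z)"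
    by (intro prod_eqI fset_eqI) (simp_all only: mem_fst_mono_split snd_mono_split map mem simps 3)
qed

lemma finite_mono_split_split:
  "finite {z. mono_split (fst (mono_split z)) = s \<and> snd (mono_split z) = c}"
proof (rule finite_subset)
  show "{z. mono_split (fst (mono_split z)) = s \<and> snd (mono_split z) = c} \<subseteq>
      (\<Union>w\<in>{w. mono_split w = s}. {z. mono_split z = (w, c)})"
    by (auto simp: prod_eq_iff)
qed (simp add: finite_mono_split_fibre)

lemma finite_mono_split_split':
  "finite {z. fst (mono_split z) = a \<and> mono_split (snd (mono_split z)) = s}"
proof (rule finite_subset)
  show "{z. fst (mono_split z) = a \<and> mono_split (snd (mono_split z)) = s} \<subseteq>
      (\<Union>w\<in>{w. mono_split w = s}. {z. mono_split z = (a, w)})"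
    by (auto simp: prod_eq_iff)
qed (simp add: finite_mono_split_fibre)

text \<open>Each side is the sum of \<open>f (mono_std z)\<close> over the shuffles \<open>z\<close>
  of \<open>a\<close>, \<open>b\<close>, \<open>c\<close>, in the alphabet
  \<open>('a + 'b) + 'c\<close> or \<open>'a + ('b + 'c)\<close>. The reassociation is an order
  isomorphism and therefore preserves \<open>mono_std z\<close>.\<close>

lemma std_coproduct_coassoc:
  "std_coproduct (\<lambda>x. std_coproduct f (x, c)) (a, b) = std_coproduct (\<lambda>y. std_coproduct f (a, y)) (b, c)"
proof -
  have "std_coproduct (\<lambda>x. std_coproduct f (x, c)) (a, b) =
      (\<Sum>w | mono_split w = (a, b). std_coproduct f (w, c))"
    \<comment> \<open>Expanding the outer coproduct evaluates the inner one at
      \<open>mono_std w\<close>; invariance replaces this by \<open>w\<close>, a monomial in the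
      compound alphabet.\<close>
    unfolding std_coproduct_apply[of _ "(a, b)"] std_coproduct_std by (rule refl)
  also have "\<dots> = (\<Sum>w | mono_split w = (a, b).
      \<Sum>z | z \<in> {z. mono_split (fst (mono_split z)) = (a, b) \<and> snd (mono_split z) = c} \<and> fst (mono_split z) = w. f (mono_std z))"
    unfolding std_coproduct_apply
  proof (intro sum.cong refl Collect_cong)
    fix w z assume "w \<in> {w. mono_split w = (a, b)}"
    then show "mono_split z = (w, c) \<longleftrightarrow> z \<in> {z. mono_split (fst (mono_split z)) = (a, b) \<and> snd (mono_split z) = c} \<and> fst (mono_split z) = w"
      by (cases "mono_split z") auto
  qed
  \<comment> \<open>Grouping by the intermediate shuffle of \<open>a\<close> and \<open>b\<close>
    merges the double sum into a single one.\<close>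
  also have "\<dots> = (\<Sum>z | mono_split (fst (mono_split z)) = (a, b) \<and> snd (mono_split z) = c. f (mono_std z))"
    by (rule sum.group) (auto simp: finite_mono_split_split finite_mono_split_fibre)
  also have "\<dots> = (\<Sum>z | fst (mono_split z) = a \<and> mono_split (snd (mono_split z)) = (b, c). f (mono_std z))"
  proof (rule sum.reindex_bij_witness[of _ "mono_map assoc_sum'" "mono_map assoc_sum"])
    have inv: "mono_map assoc_sum' (mono_map assoc_sum z) = z" "mono_map assoc_sum (mono_map assoc_sum' y) = y"
      for z :: "(('a + 'b) + 'c) mono" and y :: "('a + ('b + 'c)) mono"
      unfolding mono_map_comp by (rule mono_map_ident, simp add: assoc_sum_inverse)+
    fix z :: "(('a + 'b) + 'c) mono"
    show "mono_map assoc_sum' (mono_map assoc_sum z) = z"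
      by (rule inv)
    show "f (mono_std (mono_map assoc_sum z)) = f (mono_std z)"
      by (simp add: mono_std_map strict_mono_assoc_sum[THEN strict_monoD] strict_mono_on_def)
    assume "z \<in> {z. mono_split (fst (mono_split z)) = (a, b) \<and> snd (mono_split z) = c}"
    then show "mono_map assoc_sum z \<in> {z. fst (mono_split z) = a \<and> mono_split (snd (mono_split z)) = (b, c)}"
      by (auto simp: prod_eq_iff mono_split_assoc_sum)
  next
    have inv: "mono_map assoc_sum (mono_map assoc_sum' y) = y" for y :: "('a + ('b + 'c)) mono"
      unfolding mono_map_comp by (rule mono_map_ident, simp add: assoc_sum_inverse)
    fix y :: "('a + ('b + 'c)) mono"
    show "mono_map assoc_sum (mono_map assoc_sum' y) = y"
      by (rule inv)
    assume "y \<in> {z. fst (mono_split z) = a \<and> mono_split (snd (mono_split z)) = (b, c)}"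
    with mono_split_assoc_sum[of "mono_map assoc_sum' y"]
    show "mono_map assoc_sum' y \<in> {z. mono_split (fst (mono_split z)) = (a, b) \<and> snd (mono_split z) = c}"
      by (auto simp: prod_eq_iff inv)
  qed
  also have "\<dots> = (\<Sum>w | mono_split w = (b, c).
      \<Sum>z | z \<in> {z. fst (mono_split z) = a \<and> mono_split (snd (mono_split z)) = (b, c)} \<and> snd (mono_split z) = w. f (mono_std z))"
    by (rule sum.group[symmetric]) (auto simp: finite_mono_split_split' finite_mono_split_fibre)
  also have "\<dots> = (\<Sum>w | mono_split w = (b, c). std_coproduct f (a, w))"
    unfolding std_coproduct_apply
  proof (intro sum.cong refl Collect_cong)
    fix w z assume "w \<in> {w. mono_split w = (b, c)}"
    then show "z \<in> {z. fst (mono_split z) = a \<and> mono_split (snd (mono_split z)) = (b, c)} \<and> snd (mono_split z) = w \<longleftrightarrow> mono_split z = (a, w)"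
      by (cases "mono_split z") auto
  qed
  also have "\<dots> = std_coproduct (\<lambda>y. std_coproduct f (a, y)) (b, c)"
    unfolding std_coproduct_apply[of _ "(b, c)"] std_coproduct_std by (rule refl)
  finally show ?thesis .
qed

section \<open>Multiplicativity of the projection\<close>

lemma mono_split_mult:
  "mono_split (mono_mult w z) =
     (mono_mult (fst (mono_split w)) (fst (mono_split z)), mono_mult (snd (mono_split w)) (snd (mono_split z)))"
  by (intro prod_eqI fset_eqI) (auto simp: mem_fst_mono_split mono_mult_def snd_mono_split)

text \<open>The last factor is the Koszul sign. Every second-alphabet variable of \<open>w\<close>
  is larger than every first-alphabet variable of \<open>z\<close>, so all these pairs are
  inversions; the opposite mixed pairs contribute none.\<close>

lemma mono_sign_split:
  "mono_sign w z = mono_sign (fst (mono_split w)) (fst (mono_split z)) *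
     mono_sign (snd (mono_split w)) (snd (mono_split z)) *
     (-1) ^ (fcard (fst (snd (mono_split w))) * fcard (fst (fst (mono_split z))))"
proof -
  obtain A A' where A: "fst (fst (mono_split w)) = A" "fst (snd (mono_split w)) = A'"
    by blast
  obtain B B' where B: "fst (fst (mono_split z)) = B" "fst (snd (mono_split z)) = B'"
    by blast
  have w: "fst w = Inl |`| A |\<union>| Inr |`| A'" and z: "fst z = Inl |`| B |\<union>| Inr |`| B'"
    using fst_eq_split[of w] fst_eq_split[of z] A B by auto
  have disj: "Inl |`| C |\<inter>| Inr |`| D = {||}" for C :: "'a fset" and D :: "'b fset"
    by auto
  let ?l = "Inl :: 'a \<Rightarrow> 'a + 'b" and ?r = "Inr :: 'b \<Rightarrow> 'a + 'b"
  have "inversions (?l |`| A) (?l |`| B) = map_prod ?l ?l ` inversions A B"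
    "inversions (?r |`| A') (?r |`| B') = map_prod ?r ?r ` inversions A' B'"
    by (auto simp: inversions_def image_iff)
  then have "card (inversions (?l |`| A) (?l |`| B)) = card (inversions A B)"
    "card (inversions (?r |`| A') (?r |`| B')) = card (inversions A' B')"
    by (simp_all add: card_image inj_on_subset[OF prod.inj_map])
  moreover have "inversions (?l |`| A) (?r |`| B') = {}"
    by (auto simp: inversions_def)
  moreover have "inversions (?r |`| A') (?l |`| B) = ?r ` fset A' \<times> ?l ` fset B"
    by (auto simp: inversions_def)
  then have "card (inversions (?r |`| A') (?l |`| B)) = fcard A' * fcard B"
    by (simp add: card_image fcard.rep_eq)
  ultimately have "card (inversions (fst w) (fst z)) =
      card (inversions A B) + card (inversions A' B') + fcard A' * fcard B"
    unfolding w z by (simp add: card_inversions_union_left card_inversions_union_right disj)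
  moreover have "fst w |\<inter>| fst z = {||} \<longleftrightarrow> A |\<inter>| B = {||} \<and> A' |\<inter>| B' = {||}"
    unfolding w z by (auto simp: fset_eq_iff)
  ultimately show ?thesis
    by (simp add: mono_sign_inversions A B power_add)
qed

text \<open>The multiplication of the super tensor product, extended from pairs of monomials: the
  exponent is the product of the fermionic degrees of the two factors that pass each other.\<close>

definition super_mult ::
  "('i::linorder mono \<times> 'j::linorder mono \<Rightarrow> rat) \<Rightarrow> ('i mono \<times> 'j mono \<Rightarrow> rat) \<Rightarrow> 'i mono \<times> 'j mono \<Rightarrow> rat" where
  "super_mult s t = (\<lambda>(u, v). \<Sum>((u\<^sub>1, u\<^sub>2), (v\<^sub>1, v\<^sub>2))\<in>factorizations u \<times> factorizations v.
     mono_sign u\<^sub>1 u\<^sub>2 * mono_sign v\<^sub>1 v\<^sub>2 * (-1) ^ (fcard (fst v\<^sub>1) * fcard (fst u\<^sub>2)) * s (u\<^sub>1, v\<^sub>1) * t (u\<^sub>2, v\<^sub>2))"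

text \<open>Splitting a product splits both factors, so factoring first and splitting first
  enumerate the same pairs \<open>(x, y)\<close>; \<open>mono_sign_split\<close> supplies the sign,
  which is constant on each pair of fibres.\<close>

lemma project_series_mult: "project (series_mult F G) = super_mult (project F) (project G)"
proof
  fix uv :: "'a mono \<times> 'b mono"
  obtain u v where uv: "uv = (u, v)"
    by (cases uv)
  let ?S = "SIGMA w:{w. mono_split w = (u, v)}. factorizations w"
  let ?T = "SIGMA p:factorizations u \<times> factorizations v.
    {w. mono_split w = (fst (fst p), fst (snd p))} \<times> {w. mono_split w = (snd (fst p), snd (snd p))}"
  have "project (series_mult F G) uv = (\<Sum>(w, (x, y))\<in>?S. mono_sign x y * F x * G y)"
    unfolding project_def series_mult_def uv
    by (subst sum.Sigma) (auto simp: finite_mono_factorizations finite_mono_split_fibre)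
  also have "\<dots> = (\<Sum>(p, (x, y))\<in>?T. mono_sign x y * F x * G y)"
    by (rule sum.reindex_bij_witness[of _ "\<lambda>(p, (x, y)). (mono_mult x y, (x, y))"
          "\<lambda>(w, (x, y)). (((fst (mono_split x), fst (mono_split y)), (snd (mono_split x), snd (mono_split y))), (x, y))"])
      (auto simp: mono_split_mult, (metis fst_conv snd_conv mono_split_mult)+)
  also have "\<dots> = (\<Sum>p\<in>factorizations u \<times> factorizations v.
     \<Sum>(x, y)\<in>{w. mono_split w = (fst (fst p), fst (snd p))} \<times> {w. mono_split w = (snd (fst p), snd (snd p))}.
       mono_sign x y * F x * G y)"
    by (subst sum.Sigma) (auto simp: finite_mono_factorizations finite_mono_split_fibre)
  also have "\<dots> = super_mult (project F) (project G) uv"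
    unfolding super_mult_def uv prod.case
  proof (intro sum.cong refl)
    fix p assume "p \<in> factorizations u \<times> factorizations v"
    obtain u1 u2 v1 v2 where p: "p = ((u1, u2), (v1, v2))"
      by (metis prod.collapse)
    show "(\<Sum>(x, y)\<in>{w. mono_split w = (fst (fst p), fst (snd p))} \<times> {w. mono_split w = (snd (fst p), snd (snd p))}.
          mono_sign x y * F x * G y) =
        (\<lambda>((u\<^sub>1, u\<^sub>2), (v\<^sub>1, v\<^sub>2)).
          mono_sign u\<^sub>1 u\<^sub>2 * mono_sign v\<^sub>1 v\<^sub>2 * (-1) ^ (fcard (fst v\<^sub>1) * fcard (fst u\<^sub>2)) * project F (u\<^sub>1, v\<^sub>1) * project G (u\<^sub>2, v\<^sub>2)) p"
    proof -
      let ?c = "mono_sign u1 u2 * mono_sign v1 v2 * (-1) ^ (fcard (fst v1) * fcard (fst u2))"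
      have "(\<Sum>x | mono_split x = (u1, v1). \<Sum>y | mono_split y = (u2, v2). mono_sign x y * F x * G y) =
          (\<Sum>x | mono_split x = (u1, v1). \<Sum>y | mono_split y = (u2, v2). ?c * (F x * G y))"
        by (intro sum.cong refl) (simp add: mono_sign_split)
      also have "\<dots> = ?c * (project F (u1, v1) * project G (u2, v2))"
        unfolding project_def by (simp only: sum_distrib_left[symmetric] sum_product)
      finally show ?thesis
        unfolding p prod.case fst_conv snd_conv sum.cartesian_product[symmetric] by (simp only: mult.assoc)
    qed
  qed
  finally show "project (series_mult F G) uv = super_mult (project F) (project G) uv" .
qed

section \<open>Coproduct and antipode\<close>

lemma std_extend_ident: "f \<in> sNCQSym \<Longrightarrow> std_extend f = f"
  by (simp add: std_extend_def sNCQSym_std)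

text \<open>Ranks are taken in all of \<open>w\<close>, so the image of a factor \<open>u\<close>
  need not be \<open>mono_std u\<close>. It has the same standardization, however, and series in
  \<open>sNCQSym\<close> see nothing else.\<close>

lemma std_extend_series_mult:
  assumes f: "f \<in> sNCQSym" and g: "g \<in> sNCQSym"
  shows "std_extend (series_mult f g) = (series_mult (std_extend f) (std_extend g) :: 'i::linorder series)"
proof
  fix w :: "'i mono"
  let ?\<rho> = "rank_in (mono_ind w)"
  have mono: "strict_mono_on (mono_ind w) ?\<rho>"
    by (rule strict_mono_on_rank_in_mono_ind)
  have "std_extend (series_mult f g) w =
      (\<Sum>(u, v)\<in>factorizations w. mono_sign (mono_map ?\<rho> u) (mono_map ?\<rho> v) * f (mono_map ?\<rho> u) * g (mono_map ?\<rho> v))"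
    unfolding std_extend_def series_mult_def mono_std_eq_map
    by (rule sum_factorizations_map) (rule strict_mono_on_imp_inj_on[OF mono])
  also have "\<dots> = series_mult (std_extend f) (std_extend g) w"
    unfolding series_mult_def
  proof (intro sum.cong refl)
    fix p assume "p \<in> factorizations w"
    then obtain u v where p: "p = (u, v)" and w: "mono_mult u v = w"
      by blast
    have sub: "mono_ind u \<subseteq> mono_ind w" "mono_ind v \<subseteq> mono_ind w" "mono_ind u \<union> mono_ind v \<subseteq> mono_ind w"
      by (auto simp: w[symmetric] mono_ind_mult)
    note mono' = sub[THEN monotone_on_subset[OF mono]]
    have "f (mono_map ?\<rho> u) = std_extend f u"
      using sNCQSym_std[OF f, of "mono_map ?\<rho> u"] by (simp add: mono_std_map[OF mono'(1)] std_extend_def)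
    moreover have "g (mono_map ?\<rho> v) = std_extend g v"
      using sNCQSym_std[OF g, of "mono_map ?\<rho> v"] by (simp add: mono_std_map[OF mono'(2)] std_extend_def)
    ultimately show "(case p of (u, v) \<Rightarrow> mono_sign (mono_map ?\<rho> u) (mono_map ?\<rho> v) * f (mono_map ?\<rho> u) * g (mono_map ?\<rho> v)) =
        (case p of (u, v) \<Rightarrow> mono_sign u v * std_extend f u * std_extend g v)"
      by (simp add: p mono_sign_map[OF mono'(3)])
  qed
  finally show "std_extend (series_mult f g) w = series_mult (std_extend f) (std_extend g) w" .
qed

lemma series_mult_in_sNCQSym:
  assumes f: "f \<in> sNCQSym" and g: "g \<in> sNCQSym"
  shows "series_mult f g \<in> sNCQSym"
proof -
  obtain d where d: "\<And>u. f u \<noteq> 0 \<Longrightarrow> mono_degree u \<le> d"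
    using sNCQSym_bounded[OF f] by metis
  obtain e where e: "\<And>u. g u \<noteq> 0 \<Longrightarrow> mono_degree u \<le> e"
    using sNCQSym_bounded[OF g] by metis
  have "mono_degree w \<le> d + e" if nz: "series_mult f g w \<noteq> 0" for w
  proof -
    obtain u v where "f u \<noteq> 0" "g v \<noteq> 0" "mono_bidegree w = mono_bidegree u + mono_bidegree v"
      using nz by (rule series_mult_eq_0_or_bidegree)
    then show ?thesis
      using d[of u] e[of v] by (simp add: mono_degree_eq_bidegree)
  qed
  then have "bounded_degree (series_mult f g)"
    unfolding bounded_degree_def by blast
  \<comment> \<open>Over the alphabet \<open>nat\<close>, \<open>std_extend\<close> fixes
    \<open>f\<close> and \<open>g\<close>; being multiplicative, it fixes their product too, which
    is the required invariance.\<close>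
  moreover have "series_mult f g (mono_std w) = series_mult f g w" for w
    using fun_cong[OF std_extend_series_mult[OF f g], of w] f g
    by (simp add: std_extend_ident) (simp add: std_extend_def)
  ultimately show ?thesis
    by (simp add: sNCQSym_iff)
qed

lemma series_one_in_sNCQSym: "series_one \<in> sNCQSym"
  unfolding sNCQSym_iff bounded_degree_def by (auto simp: series_one_def simp del: split_paired_All split_paired_Ex)

lemma std_coproduct_nonzero:
  assumes "std_coproduct f (u, v) \<noteq> 0"
  obtains z where "f z \<noteq> 0" and "mono_bidegree z = mono_bidegree u + mono_bidegree v"
proof -
  from assms obtain z where z: "mono_split z = (u, v)" "f (mono_std z) \<noteq> 0"
    unfolding std_coproduct_apply by (metis (mono_tags, lifting) mem_Collect_eq sum.neutral)
  with mono_bidegree_split[of z] show ?thesis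
    by (intro that[of "mono_std z"]) auto
qed

lemma std_coproduct_add: "std_coproduct (f + g) t = std_coproduct f t + std_coproduct g t"
  by (simp add: std_coproduct_apply sum.distrib)

lemma std_coproduct_scale: "std_coproduct (fscale c f) t = c * std_coproduct f t"
  by (simp add: std_coproduct_apply fscale_def sum_distrib_left)

text \<open>Exchanging the sum over basis elements with the sum over shuffles leaves, at each
  shuffle, the expansion of \<open>f\<close> at its standardization.\<close>

lemma coproduct_eq_std_coproduct:
  assumes f: "f \<in> sNCQSym"
  shows "coproduct f = std_coproduct f"
proof
  fix t
  let ?K = "mono_supercomp ` {u. f u \<noteq> 0}"
  have fin: "finite ?K"
    using f by (rule finite_supercomp_support)
  have inv: "f u = f v" if "mono_supercomp u = mono_supercomp v" for u v
    using f that unfolding mono_supercomp_eq_iff sNCQSym_def by blast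
  have "coproduct f t = (\<Sum>I\<in>?K. f (SOME u. mono_supercomp u = I) * (\<Sum>z | mono_split z = t. if mono_supercomp z = I then 1 else 0))"
    by (simp only: coproduct_def coproduct_M_def project_def M_def sum_fun_apply fscale_def)
  also have "\<dots> = (\<Sum>z | mono_split z = t. \<Sum>I\<in>?K. f (SOME u. mono_supercomp u = I) * (if mono_supercomp z = I then 1 else 0))"
    unfolding sum_distrib_left by (rule sum.swap)
  also have "\<dots> = std_coproduct f t"
    unfolding std_coproduct_apply
  proof (intro sum.cong refl)
    fix z :: "(nat + nat) mono"
    show "(\<Sum>I\<in>?K. f (SOME u. mono_supercomp u = I) * (if mono_supercomp z = I then 1 else 0)) = f (mono_std z)"
      using class_function_expansion[where \<kappa> = mono_supercomp and f = f and u = "mono_std z", OF fin inv] by simp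
  qed
  finally show "coproduct f t = std_coproduct f t" .
qed

lemma M_supercomp_in_sNCQSym: "M (mono_supercomp u) \<in> sNCQSym"
  by (rule M_in_sNCQSym[OF set_supercomposition_mono_supercomp])

lemma M_supercomp_homogeneous:
  assumes "\<And>v. mono_bidegree v = mono_bidegree u \<Longrightarrow> d v = d u" and "M (mono_supercomp u) v \<noteq> 0"
  shows "d v = d u"
  using assms(2) by (intro assms(1)) (metis M_mono_supercomp mono_bidegree_std)

lemma std_coproduct_in_span:
  assumes f: "f \<in> sNCQSym"
  shows "std_coproduct f \<in>
    fun_space.span {(M (mono_supercomp a) :: nat series) \<otimes>\<^sub>v (M (mono_supercomp b) :: nat series) |a b. std_coproduct f (a :: nat mono, b :: nat mono) \<noteq> 0}"
proof -
  obtain d where d: "\<And>u. f u \<noteq> 0 \<Longrightarrow> mono_degree u \<le> d"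
    using sNCQSym_bounded[OF f] by metis
  show ?thesis
  proof (rule tensor_space_class_functions)
    fix u v :: "nat mono"
    show "std_coproduct f (mono_std u, mono_std v) = std_coproduct f (u, v)"
      by (simp only: std_coproduct_std)
    assume "std_coproduct f (u, v) \<noteq> 0"
    then obtain z where "f z \<noteq> 0" and "mono_bidegree z = mono_bidegree u + mono_bidegree v"
      by (rule std_coproduct_nonzero)
    with d[of z] show "mono_degree u \<le> d \<and> mono_degree v \<le> d"
      by (simp add: mono_degree_eq_bidegree)
  qed
qed

lemma std_coproduct_in_tensor_space:
  assumes "f \<in> sNCQSym"
  shows "std_coproduct f \<in> sNCQSym \<otimes>\<^sub>S sNCQSym"
  using std_coproduct_in_span[OF assms] unfolding tensor_space_def
  by (rule rev_subsetD) (intro fun_space.span_mono, use M_supercomp_in_sNCQSym in blast)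

text \<open>A pair with nonzero coefficient comes from a shuffle in the support of \<open>f\<close>,
  whose bidegree is the sum of the two. Any degree \<open>d\<close> that is additive in the bidegree
  inherits this, so parity and bidegree are treated together.\<close>

lemma std_coproduct_in_tensor_grading:
  fixes d :: "nat mono \<Rightarrow> 'g::comm_monoid_add"
  assumes f: "f \<in> sNCQSym" and hom: "\<And>u. f u \<noteq> 0 \<Longrightarrow> d u = i"
    and d: "\<And>u v w. mono_bidegree w = mono_bidegree u + mono_bidegree v \<Longrightarrow> d w = d u + d v"
    and d': "\<And>u v. mono_bidegree u = mono_bidegree v \<Longrightarrow> d u = d v"
    and G: "\<And>i. G i = {f \<in> sNCQSym. \<forall>u. f u \<noteq> 0 \<longrightarrow> d u = i}"
  shows "std_coproduct f \<in> tensor_grading G i"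
  using std_coproduct_in_span[OF f] unfolding tensor_grading_def
proof (rule rev_subsetD, intro fun_space.span_mono subsetI)
  fix t assume "t \<in> {(M (mono_supercomp a) :: nat series) \<otimes>\<^sub>v (M (mono_supercomp b) :: nat series) |a b. std_coproduct f (a :: nat mono, b :: nat mono) \<noteq> 0}"
  then obtain a b :: "nat mono" where t: "t = M (mono_supercomp a) \<otimes>\<^sub>v M (mono_supercomp b)" and nz: "std_coproduct f (a, b) \<noteq> 0"
    by blast
  have "M (mono_supercomp u) \<in> G (d u)" for u
    unfolding G using M_supercomp_in_sNCQSym M_supercomp_homogeneous[of u d] d' by blast
  moreover have "d a + d b = i"
  proof -
    obtain z where "f z \<noteq> 0" "mono_bidegree z = mono_bidegree a + mono_bidegree b"
      using nz by (rule std_coproduct_nonzero)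
    then show ?thesis
      using hom d by metis
  qed
  ultimately show "t \<in> {f \<otimes>\<^sub>v g |f g. \<exists>j k. f \<in> G j \<and> g \<in> G k \<and> j + k = i}"
    unfolding t by blast
qed

section \<open>Left and right antipode\<close>

lemma mono_degree_less:
  assumes "mono_sign u v \<noteq> 0"
  shows "v \<noteq> mono_one \<Longrightarrow> mono_degree u < mono_degree (mono_mult u v)"
    and "u \<noteq> mono_one \<Longrightarrow> mono_degree v < mono_degree (mono_mult u v)"
  using mono_bidegree_mult[OF assms] mono_bidegree_eq_0_iff[of u] mono_bidegree_eq_0_iff[of v]
  by (auto simp: mono_degree_eq_bidegree prod_eq_iff)

text \<open>The equation for a left convolution inverse of the identity, solved for the
  factorization \<open>(w, mono_one)\<close>. The other first factors have smaller degree only when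
  the sign is nonzero: with a repeated anticommuting variable \<open>mono_mult\<close> may return
  the first factor itself. So terms of sign zero, harmless in the sum, are filtered out for
  termination.\<close>

function antipode :: "nat series \<Rightarrow> nat series" where
  "antipode f w = (if w = mono_one then counit f else 0) -
     (\<Sum>p\<in>{p \<in> factorizations w. snd p \<noteq> mono_one \<and> mono_sign (fst p) (snd p) \<noteq> 0}.
        mono_sign (fst p) (snd p) * antipode (\<lambda>a. std_coproduct f (a, snd p)) (fst p))"
  by pat_completeness auto
termination
proof (relation "measure (\<lambda>(f, w). mono_degree w)")
  fix f w p assume "p \<in> {p \<in> factorizations w. snd p \<noteq> mono_one \<and> mono_sign (fst p) (snd p) \<noteq> 0}"
  then have "mono_degree (fst p) < mono_degree (mono_mult (fst p) (snd p))" "mono_mult (fst p) (snd p) = w"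
    by (auto intro!: mono_degree_less(1) simp del: prod_eq_iff)
  then show "((\<lambda>a. std_coproduct f (a, snd p), fst p), f, w) \<in> measure (\<lambda>(f, w). mono_degree w)"
    by simp
qed simp

text \<open>The mirror recursion gives a right convolution inverse. It is auxiliary and will be
  shown to coincide with \<open>antipode\<close>.\<close>

function right_antipode :: "nat series \<Rightarrow> nat series" where
  "right_antipode f w = (if w = mono_one then counit f else 0) -
     (\<Sum>p\<in>{p \<in> factorizations w. fst p \<noteq> mono_one \<and> mono_sign (fst p) (snd p) \<noteq> 0}.
        mono_sign (fst p) (snd p) * right_antipode (\<lambda>a. std_coproduct f (fst p, a)) (snd p))"
  by pat_completeness auto
termination
proof (relation "measure (\<lambda>(f, w). mono_degree w)")
  fix f w p assume "p \<in> {p \<in> factorizations w. fst p \<noteq> mono_one \<and> mono_sign (fst p) (snd p) \<noteq> 0}"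
  then have "mono_degree (snd p) < mono_degree (mono_mult (fst p) (snd p))" "mono_mult (fst p) (snd p) = w"
    by (auto intro!: mono_degree_less(2) simp del: prod_eq_iff)
  then show "((\<lambda>a. std_coproduct f (fst p, a), snd p), f, w) \<in> measure (\<lambda>(f, w). mono_degree w)"
    by simp
qed simp

declare antipode.simps [simp del] right_antipode.simps [simp del]

lemma counit_comp_std: "counit (\<lambda>a. f (mono_std a)) = counit f"
proof -
  have "mono_std (mono_one :: nat mono) = mono_one"
    by simp
  then show ?thesis
    by (simp only: counit_def)
qed

text \<open>The slice of the coproduct at \<open>mono_one\<close> is \<open>f\<close> composed with
  \<open>mono_std\<close>, which need not be \<open>f\<close> outside \<open>sNCQSym\<close>. The
  recursion cannot tell them apart, as it reads \<open>f\<close> only through \<open>counit\<close>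
  and \<open>std_coproduct\<close>.\<close>

lemma antipode_comp_std: "antipode (\<lambda>a. f (mono_std a)) = antipode f"
  by (rule ext, subst (1 2) antipode.simps) (simp only: counit_comp_std std_coproduct_comp_std)

lemma right_antipode_comp_std: "right_antipode (\<lambda>a. f (mono_std a)) = right_antipode f"
  by (rule ext, subst (1 2) right_antipode.simps) (simp only: counit_comp_std std_coproduct_comp_std)

text \<open>The recursion rearranged: the filtered terms reappear with the factorization
  \<open>(w, mono_one)\<close>, which contributes \<open>antipode f w\<close>. Every remaining term
  has sign zero.\<close>

lemma antipode_convolution:
  "(\<Sum>p\<in>factorizations w. mono_sign (fst p) (snd p) * antipode (\<lambda>a. std_coproduct f (a, snd p)) (fst p)) =
   (if w = mono_one then counit f else 0)"
proof -
  let ?h = "\<lambda>p. mono_sign (fst p) (snd p) * antipode (\<lambda>a. std_coproduct f (a, snd p)) (fst p)"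
  let ?T = "{p \<in> factorizations w. snd p \<noteq> mono_one \<and> mono_sign (fst p) (snd p) \<noteq> 0}"
  have fin: "finite ?T"
    by (rule finite_subset[OF _ finite_mono_factorizations[of w]]) blast
  have "sum ?h (factorizations w) = sum ?h (insert (w, mono_one) ?T)"
    by (rule sum.mono_neutral_right) (auto simp: finite_mono_factorizations)
  also have "\<dots> = antipode f w + sum ?h ?T"
    using fin by (subst sum.insert) (simp_all add: std_coproduct_one_right antipode_comp_std)
  finally show ?thesis
    by (simp add: antipode.simps[of f w])
qed

lemma right_antipode_convolution:
  "(\<Sum>p\<in>factorizations w. mono_sign (fst p) (snd p) * right_antipode (\<lambda>a. std_coproduct f (fst p, a)) (snd p)) =
   (if w = mono_one then counit f else 0)"
proof -
  let ?h = "\<lambda>p. mono_sign (fst p) (snd p) * right_antipode (\<lambda>a. std_coproduct f (fst p, a)) (snd p)"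
  let ?T = "{p \<in> factorizations w. fst p \<noteq> mono_one \<and> mono_sign (fst p) (snd p) \<noteq> 0}"
  have fin: "finite ?T"
    by (rule finite_subset[OF _ finite_mono_factorizations[of w]]) blast
  have "sum ?h (factorizations w) = sum ?h (insert (mono_one, w) ?T)"
    by (rule sum.mono_neutral_right) (auto simp: finite_mono_factorizations)
  also have "\<dots> = right_antipode f w + sum ?h ?T"
    using fin by (subst sum.insert) (simp_all add: std_coproduct_one_left right_antipode_comp_std)
  finally show ?thesis
    by (simp add: right_antipode.simps[of f w])
qed

text \<open>The recursion applies the antipode to slices rather than to \<open>f\<close> and
  \<open>g\<close>, so the induction on the degree generalizes over the functions.\<close>

lemma linear_on_antipode: "linear_on UNIV fscale antipode"
proof (rule linear_onI_fscale)
  fix f g :: "nat series" and w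
  show "antipode (f + g) w = antipode f w + antipode g w"
  proof (induction "mono_degree w" arbitrary: f g w rule: less_induct)
    case less
    let ?T = "{p \<in> factorizations w. snd p \<noteq> mono_one \<and> mono_sign (fst p) (snd p) \<noteq> 0}"
    have "antipode (\<lambda>a. std_coproduct (f + g) (a, snd p)) (fst p) =
        antipode (\<lambda>a. std_coproduct f (a, snd p)) (fst p) + antipode (\<lambda>a. std_coproduct g (a, snd p)) (fst p)"
      if "p \<in> ?T" for p
    proof -
      have "mono_degree (fst p) < mono_degree w"
        using that mono_degree_less(1)[of "fst p" "snd p"] by auto
      moreover have eq: "(\<lambda>a. std_coproduct (f + g) (a, snd p)) = (\<lambda>a. std_coproduct f (a, snd p)) + (\<lambda>a. std_coproduct g (a, snd p))"
        by (rule ext) (simp only: std_coproduct_add plus_fun_apply)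
      ultimately show ?thesis
        by (intro trans[OF arg_cong[OF eq, of "\<lambda>x. antipode x (fst p)"] less])
    qed
    then show ?case
      by (simp add: antipode.simps[of _ w] counit_def sum.distrib algebra_simps)
  qed
next
  fix c f w
  show "antipode (fscale c f) w = c * antipode f w"
  proof (induction "mono_degree w" arbitrary: f w rule: less_induct)
    case less
    let ?T = "{p \<in> factorizations w. snd p \<noteq> mono_one \<and> mono_sign (fst p) (snd p) \<noteq> 0}"
    have "antipode (\<lambda>a. std_coproduct (fscale c f) (a, snd p)) (fst p) =
        c * antipode (\<lambda>a. std_coproduct f (a, snd p)) (fst p)"
      if "p \<in> ?T" for p
    proof -
      have "mono_degree (fst p) < mono_degree w"
        using that mono_degree_less(1)[of "fst p" "snd p"] by auto
      moreover have eq: "(\<lambda>a. std_coproduct (fscale c f) (a, snd p)) = fscale c (\<lambda>a. std_coproduct f (a, snd p))"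
        by (simp only: std_coproduct_scale) (simp only: fscale_def)
      ultimately show ?thesis
        by (intro trans[OF arg_cong[OF eq, of "\<lambda>x. antipode x (fst p)"] less])
    qed
    then show ?case
      by (simp add: antipode.simps[of _ w] counit_def fscale_def sum_distrib_left algebra_simps)
  qed
qed

lemma linear_on_right_antipode: "linear_on UNIV fscale right_antipode"
proof (rule linear_onI_fscale)
  fix f g :: "nat series" and w
  show "right_antipode (f + g) w = right_antipode f w + right_antipode g w"
  proof (induction "mono_degree w" arbitrary: f g w rule: less_induct)
    case less
    let ?T = "{p \<in> factorizations w. fst p \<noteq> mono_one \<and> mono_sign (fst p) (snd p) \<noteq> 0}"
    have "right_antipode (\<lambda>a. std_coproduct (f + g) (fst p, a)) (snd p) =
        right_antipode (\<lambda>a. std_coproduct f (fst p, a)) (snd p) + right_antipode (\<lambda>a. std_coproduct g (fst p, a)) (snd p)"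
      if "p \<in> ?T" for p
    proof -
      have "mono_degree (snd p) < mono_degree w"
        using that mono_degree_less(2)[of "fst p" "snd p"] by auto
      moreover have eq: "(\<lambda>a. std_coproduct (f + g) (fst p, a)) = (\<lambda>a. std_coproduct f (fst p, a)) + (\<lambda>a. std_coproduct g (fst p, a))"
        by (rule ext) (simp only: std_coproduct_add plus_fun_apply)
      ultimately show ?thesis
        by (intro trans[OF arg_cong[OF eq, of "\<lambda>x. right_antipode x (snd p)"] less])
    qed
    then show ?case
      by (simp add: right_antipode.simps[of _ w] counit_def sum.distrib algebra_simps)
  qed
next
  fix c f w
  show "right_antipode (fscale c f) w = c * right_antipode f w"
  proof (induction "mono_degree w" arbitrary: f w rule: less_induct)
    case less
    let ?T = "{p \<in> factorizations w. fst p \<noteq> mono_one \<and> mono_sign (fst p) (snd p) \<noteq> 0}"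
    have "right_antipode (\<lambda>a. std_coproduct (fscale c f) (fst p, a)) (snd p) =
        c * right_antipode (\<lambda>a. std_coproduct f (fst p, a)) (snd p)"
      if "p \<in> ?T" for p
    proof -
      have "mono_degree (snd p) < mono_degree w"
        using that mono_degree_less(2)[of "fst p" "snd p"] by auto
      moreover have eq: "(\<lambda>a. std_coproduct (fscale c f) (fst p, a)) = fscale c (\<lambda>a. std_coproduct f (fst p, a))"
        by (simp only: std_coproduct_scale) (simp only: fscale_def)
      ultimately show ?thesis
        by (intro trans[OF arg_cong[OF eq, of "\<lambda>x. right_antipode x (snd p)"] less])
    qed
    then show ?case
      by (simp add: right_antipode.simps[of _ w] counit_def fscale_def sum_distrib_left algebra_simps)
  qed
qed

text \<open>Functionals that are finite linear combinations of coefficient evaluations. An arbitrary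
  linear functional on a function space need not commute with a map acting in another variable;
  these do.\<close>

definition finitary :: "(('m \<Rightarrow> 'k::field) \<Rightarrow> 'k) \<Rightarrow> bool" where
  "finitary \<phi> \<longleftrightarrow> \<phi> \<in> fun_space.span (range (\<lambda>a f. f a))"

lemma finitary_induct [consumes 1, case_names zero add]:
  assumes "finitary \<phi>" and "Q (\<lambda>f. 0)"
    and "\<And>c a \<psi>. Q \<psi> \<Longrightarrow> Q (\<lambda>f. c * f a + \<psi> f)"
  shows "Q \<phi>"
  using assms(1) unfolding finitary_def
proof (induction rule: fun_space.span_induct_alt)
  case base
  then show ?case
    using assms(2) by (simp add: zero_fun_def)
next
  case (step c x y)
  then show ?case
    using assms(3) by (auto simp: fscale_def plus_fun_def)
qed

lemma finitary_eval: "finitary (\<lambda>f. f a)"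
  unfolding finitary_def by (rule fun_space.span_base) blast

lemma finitary_zero: "finitary (\<lambda>f. 0)"
  unfolding finitary_def using fun_space.span_zero[of "range (\<lambda>a f. f a)"] unfolding zero_fun_def .

lemma finitary_add: "finitary \<phi> \<Longrightarrow> finitary \<psi> \<Longrightarrow> finitary (\<lambda>f. \<phi> f + \<psi> f)"
  unfolding finitary_def using fun_space.span_add[of \<phi> _ \<psi>] unfolding plus_fun_def .

lemma finitary_scale: "finitary \<phi> \<Longrightarrow> finitary (\<lambda>f. c * \<phi> f)"
  unfolding finitary_def using fun_space.span_scale[of \<phi> _ c] unfolding fscale_def .

lemma finitary_diff: "finitary \<phi> \<Longrightarrow> finitary \<psi> \<Longrightarrow> finitary (\<lambda>f. \<phi> f - \<psi> f)"
  using finitary_add[of \<phi> "\<lambda>f. - 1 * \<psi> f"] finitary_scale[of \<psi> "- 1"] by simp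

lemma finitary_sum: "(\<And>i. i \<in> I \<Longrightarrow> finitary (\<phi> i)) \<Longrightarrow> finitary (\<lambda>f. \<Sum>i\<in>I. \<phi> i f)"
  by (induction I rule: infinite_finite_induct) (auto intro: finitary_zero finitary_add)

lemma finitary_comp:
  assumes "finitary \<phi>" and "\<And>a. finitary (\<lambda>f. F f a)"
  shows "finitary (\<lambda>f. \<phi> (F f))"
  using assms(1)
proof (induction rule: finitary_induct)
  case zero
  show ?case
    by (rule finitary_zero)
next
  case (add c a \<psi>)
  then show ?case
    by (intro finitary_add finitary_scale assms(2))
qed

text \<open>For a finite combination of evaluations, linearity of \<open>L\<close> moves it through
  the sum. This is the interchange of maps acting on two different tensor slots.\<close>

lemma finitary_commute:
  assumes "finitary \<phi>" and L: "linear_on UNIV fscale L"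
  shows "\<phi> (\<lambda>a. L (t a) x) = L (\<lambda>c. \<phi> (\<lambda>a. t a c)) x"
  using assms(1)
proof (induction rule: finitary_induct)
  case zero
  then show ?case
    using linear_on_fun_sum[OF L, of "{}"] by simp
next
  case (add k a \<psi>)
  have "(\<lambda>c. k * t a c + \<psi> (\<lambda>a. t a c)) = fscale k (t a) + (\<lambda>c. \<psi> (\<lambda>a. t a c))"
    by (simp add: fscale_def plus_fun_def)
  moreover have "L (fscale k (t a) + (\<lambda>c. \<psi> (\<lambda>a. t a c))) x = k * L (t a) x + L (\<lambda>c. \<psi> (\<lambda>a. t a c)) x"
    using L by (simp add: linear_on_def fscale_def)
  ultimately show ?case
    using add by simp
qed

text \<open>Coproduct coefficients are finite sums of coefficients, and the recursion has finitely
  many terms of smaller degree, so unfolding it ends in finitely many evaluations of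
  \<open>f\<close>.\<close>

lemma finitary_antipode: "finitary (\<lambda>f. antipode f w)"
proof (induction "mono_degree w" arbitrary: w rule: less_induct)
  case less
  have cop: "finitary (\<lambda>f. std_coproduct f t)" for t :: "nat mono \<times> nat mono"
    unfolding std_coproduct_apply by (intro finitary_sum finitary_eval)
  have "finitary (\<lambda>f. antipode (\<lambda>a. std_coproduct f (a, snd p)) (fst p))"
    if "p \<in> {p \<in> factorizations w. snd p \<noteq> mono_one \<and> mono_sign (fst p) (snd p) \<noteq> 0}" for p
  proof (rule finitary_comp[of "\<lambda>f. antipode f (fst p)" "\<lambda>f a. std_coproduct f (a, snd p)"])
    show "finitary (\<lambda>f. antipode f (fst p))"
      using that mono_degree_less(1)[of "fst p" "snd p"] by (intro less) auto
  qed (rule cop)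
  moreover have "finitary (\<lambda>f. if w = mono_one then counit f else 0)"
    by (cases "w = mono_one") (auto simp: counit_def intro: finitary_eval finitary_zero)
  ultimately show ?case
    unfolding antipode.simps[of _ w] by (intro finitary_diff finitary_sum finitary_scale)
qed

text \<open>
  Both sides compute the convolution of \<^const>\<open>antipode\<close>, the identity and \<^const>\<open>right_antipode\<close>,
  bracketed in the two possible ways.
\<close>

lemma antipode_eq_right_antipode: "antipode f w = right_antipode f w"
proof -
  let ?L = antipode and ?R = right_antipode
  \<comment> \<open>The coefficient of the iterated coproduct at \<open>a\<close>, \<open>v\<close>,
    \<open>c\<close>; coassociativity makes both bracketings available.\<close>
  define D :: "nat mono \<Rightarrow> nat mono \<Rightarrow> nat mono \<Rightarrow> rat"
    where "D a v c = std_coproduct (\<lambda>b. std_coproduct f (b, c)) (a, v)" for a v c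
  have D: "D a v c = std_coproduct (\<lambda>b. std_coproduct f (a, b)) (v, c)" for a v c
    unfolding D_def by (rule std_coproduct_coassoc)
  \<comment> \<open>The summand of the triple convolution, signed for the left bracketing;
    \<open>mono_sign_cocycle\<close> converts it to the right one.\<close>
  define H where "H u v x = mono_sign u v * mono_sign (mono_mult u v) x * ?L (\<lambda>a. ?R (\<lambda>c. D a v c) x) u" for u v x
  have left: "(\<Sum>(u, v)\<in>factorizations p. H u v x) = (if p = mono_one then ?R f x else 0) * mono_sign p x" for p x
  proof -
    have "(\<Sum>(u, v)\<in>factorizations p. H u v x) =
        mono_sign p x * (\<Sum>q\<in>factorizations p. mono_sign (fst q) (snd q) * ?R (\<lambda>c. ?L (\<lambda>a. D a (snd q) c) (fst q)) x)"
      unfolding sum_distrib_left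
    proof (intro sum.cong refl)
      fix q assume "q \<in> factorizations p"
      then have "mono_mult (fst q) (snd q) = p"
        by auto
      \<comment> \<open>Interchanging the two antipodes puts the left one inside, where its
        convolution with the identity collapses to the counit.\<close>
      then show "(case q of (u, v) \<Rightarrow> H u v x) =
          mono_sign p x * (mono_sign (fst q) (snd q) * ?R (\<lambda>c. ?L (\<lambda>a. D a (snd q) c) (fst q)) x)"
        by (simp only: split_beta H_def finitary_commute[OF finitary_antipode linear_on_right_antipode] ac_simps)
    qed
    also have "\<dots> = mono_sign p x * ?R (\<lambda>c. \<Sum>q\<in>factorizations p. mono_sign (fst q) (snd q) * ?L (\<lambda>a. D a (snd q) c) (fst q)) x"
      by (simp only: linear_on_fun_sum[OF linear_on_right_antipode finite_mono_factorizations])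
    also have "(\<lambda>c. \<Sum>q\<in>factorizations p. mono_sign (fst q) (snd q) * ?L (\<lambda>a. D a (snd q) c) (fst q)) =
        (\<lambda>c. (if p = mono_one then 1 else 0) * f (mono_std c))"
      unfolding D_def antipode_convolution by (auto simp: counit_def std_coproduct_one_left)
    also have "?R \<dots> x = (if p = mono_one then 1 else 0) * ?R f x"
    proof -
      have "?R (fscale k (\<lambda>c. f (mono_std c))) x = k * ?R f x" for k
        using linear_on_right_antipode by (simp add: linear_on_def right_antipode_comp_std) (simp add: fscale_def)
      then show ?thesis
        unfolding fscale_def .
    qed
    finally show ?thesis
      by simp
  qed
  have right: "(\<Sum>(v, x)\<in>factorizations q. H u v x) = (if q = mono_one then ?L f u else 0) * mono_sign u q" for u q
  proof -
    have "(\<Sum>(v, x)\<in>factorizations q. H u v x) =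
        mono_sign u q * (\<Sum>p\<in>factorizations q. mono_sign (fst p) (snd p) * ?L (\<lambda>a. ?R (\<lambda>c. D a (fst p) c) (snd p)) u)"
      unfolding sum_distrib_left
    proof (intro sum.cong refl)
      fix p assume "p \<in> factorizations q"
      then have "mono_mult (fst p) (snd p) = q"
        by auto
      then show "(case p of (v, x) \<Rightarrow> H u v x) =
          mono_sign u q * (mono_sign (fst p) (snd p) * ?L (\<lambda>a. ?R (\<lambda>c. D a (fst p) c) (snd p)) u)"
        by (simp only: split_beta H_def mono_sign_cocycle ac_simps)
    qed
    also have "\<dots> = mono_sign u q * ?L (\<lambda>a. \<Sum>p\<in>factorizations q. mono_sign (fst p) (snd p) * ?R (\<lambda>c. D a (fst p) c) (snd p)) u"
      by (simp only: linear_on_fun_sum[OF linear_on_antipode finite_mono_factorizations])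
    also have "(\<lambda>a. \<Sum>p\<in>factorizations q. mono_sign (fst p) (snd p) * ?R (\<lambda>c. D a (fst p) c) (snd p)) =
        (\<lambda>a. (if q = mono_one then 1 else 0) * f (mono_std a))"
      unfolding D right_antipode_convolution by (auto simp: counit_def std_coproduct_one_right)
    also have "?L \<dots> u = (if q = mono_one then 1 else 0) * ?L f u"
    proof -
      have "?L (fscale k (\<lambda>a. f (mono_std a))) u = k * ?L f u" for k
        using linear_on_antipode by (simp add: linear_on_def antipode_comp_std) (simp add: fscale_def)
      then show ?thesis
        unfolding fscale_def .
    qed
    finally show ?thesis
      by simp
  qed
  \<comment> \<open>The collapsed inner sums leave only the factorization
    \<open>(mono_one, w)\<close> here, and only \<open>(w, mono_one)\<close> in the other
    bracketing.\<close>
  have "?R f w = (\<Sum>(p, x)\<in>factorizations w. \<Sum>(u, v)\<in>factorizations p. H u v x)"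
    unfolding left by (subst sum_single[of _ "(mono_one, w)"]) (auto simp: finite_mono_factorizations split: if_splits)
  also have "\<dots> = (\<Sum>(u, q)\<in>factorizations w. \<Sum>(v, x)\<in>factorizations q. H u v x)"
    by (rule sum_factorizations_assoc)
  also have "\<dots> = ?L f w"
    unfolding right by (subst sum_single[of _ "(w, mono_one)"]) (auto simp: finite_mono_factorizations split: if_splits)
  finally show ?thesis ..
qed

text \<open>Each recursive term preserves the bidegree, since the coproduct and products of nonzero
  sign add bidegrees. This yields bounded degree as well as both homogeneity properties of the
  antipode.\<close>

lemma antipode_nonzero:
  assumes "antipode f w \<noteq> 0"
  shows "\<exists>u. f u \<noteq> 0 \<and> mono_bidegree u = mono_bidegree w"
  using assms
proof (induction "mono_degree w" arbitrary: f w rule: less_induct)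
  case less
  let ?T = "{p \<in> factorizations w. snd p \<noteq> mono_one \<and> mono_sign (fst p) (snd p) \<noteq> 0}"
  let ?h = "\<lambda>p. mono_sign (fst p) (snd p) * antipode (\<lambda>a. std_coproduct f (a, snd p)) (fst p)"
  have "antipode f w = (if w = mono_one then counit f else 0) - sum ?h ?T"
    by (rule antipode.simps)
  with less.prems have nz: "(if w = mono_one then counit f else 0) - sum ?h ?T \<noteq> 0"
    by simp
  show ?case
  proof (cases "sum ?h ?T = 0")
    case True
    with nz have "w = mono_one" "counit f \<noteq> 0"
      by (simp_all only: diff_zero not_False_eq_True split: if_splits)
    then show ?thesis
      unfolding counit_def by blast
  next
    case False
    then obtain p where p: "p \<in> ?T" "?h p \<noteq> 0"
      by (rule sum.not_neutral_contains_not_neutral)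
    define u v where "u = fst p" and "v = snd p"
    have uv: "mono_mult u v = w" "v \<noteq> mono_one" "mono_sign u v \<noteq> 0"
      and nz: "antipode (\<lambda>a. std_coproduct f (a, v)) u \<noteq> 0"
      using p by (auto simp: u_def v_def)
    have "mono_degree u < mono_degree w"
      using mono_degree_less(1)[OF uv(3,2)] uv(1) by simp
    from less.hyps[OF this nz] obtain a :: "nat mono" where "std_coproduct f (a, v) \<noteq> 0" and a: "mono_bidegree a = mono_bidegree u"
      by blast
    then obtain z where "f z \<noteq> 0" "mono_bidegree z = mono_bidegree a + mono_bidegree v"
      by (elim std_coproduct_nonzero)
    then show ?thesis
      using a mono_bidegree_mult[OF uv(3)] uv(1) by metis
  qed
qed

lemma antipode_std: "antipode f (mono_std w) = antipode f w"
proof (induction "mono_degree w" arbitrary: f w rule: less_induct)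
  case less
  let ?\<rho> = "rank_in (mono_ind w)"
  have mono: "strict_mono_on (mono_ind w) ?\<rho>"
    by (rule strict_mono_on_rank_in_mono_ind)
  let ?h = "\<lambda>u v. if v \<noteq> mono_one \<and> mono_sign u v \<noteq> 0 then mono_sign u v * antipode (\<lambda>a. std_coproduct f (a, v)) u else 0"
  have split: "antipode f y = (if y = mono_one then counit f else 0) - (\<Sum>(u, v)\<in>factorizations y. ?h u v)" for y
    unfolding antipode.simps[of f y] split_beta sum.inter_filter[OF finite_mono_factorizations] by (rule refl)
  have "(\<Sum>(u, v)\<in>factorizations (mono_std w). ?h u v) = (\<Sum>(u, v)\<in>factorizations w. ?h (mono_map ?\<rho> u) (mono_map ?\<rho> v))"
    unfolding mono_std_eq_map by (rule sum_factorizations_map) (rule strict_mono_on_imp_inj_on[OF mono])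
  also have "\<dots> = (\<Sum>(u, v)\<in>factorizations w. ?h u v)"
  proof (intro sum.cong refl)
    fix p assume "p \<in> factorizations w"
    then obtain u v where p: "p = (u, v)" and w: "mono_mult u v = w"
      by blast
    have sub: "mono_ind u \<subseteq> mono_ind w" "mono_ind v \<subseteq> mono_ind w" "mono_ind u \<union> mono_ind v \<subseteq> mono_ind w"
      by (auto simp: w[symmetric] mono_ind_mult)
    note mono' = sub[THEN monotone_on_subset[OF mono]]
    have "std_coproduct f (a, mono_map ?\<rho> v) = std_coproduct f (a, v)" for a :: "nat mono"
      using std_coproduct_map[OF strict_mono_on_id' mono'(2), of f a] by (simp add: mono_map_id)
    moreover have "antipode g (mono_map ?\<rho> u) = antipode g u" if "v \<noteq> mono_one" "mono_sign u v \<noteq> 0" for g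
    proof -
      have deg: "mono_degree u < mono_degree w"
        using mono_degree_less(1)[OF that(2,1)] w by simp
      have "mono_degree (mono_map ?\<rho> u) = mono_degree u"
        using mono_bidegree_map[OF strict_mono_on_imp_inj_on[OF mono'(1)]] by (simp add: mono_degree_eq_bidegree)
      \<comment> \<open>The hypothesis concerns only \<open>mono_std\<close>, so it is used for
        \<open>u\<close> and for its relabelling, which share one standardization.\<close>
      with deg less[of "mono_map ?\<rho> u" g] less[of u g] show ?thesis
        by (simp add: mono_std_map[OF mono'(1)])
    qed
    ultimately show "(case p of (u, v) \<Rightarrow> ?h (mono_map ?\<rho> u) (mono_map ?\<rho> v)) = (case p of (u, v) \<Rightarrow> ?h u v)"
      by (simp add: p mono_sign_map[OF mono'(3)])
  qed
  finally show ?case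
    unfolding split by simp
qed

lemma antipode_in_sNCQSym:
  assumes "f \<in> sNCQSym"
  shows "antipode f \<in> sNCQSym"
proof -
  obtain d where "\<And>u. f u \<noteq> 0 \<Longrightarrow> mono_degree u \<le> d"
    using sNCQSym_bounded[OF assms] by metis
  then have "mono_degree w \<le> d" if "antipode f w \<noteq> 0" for w
    using antipode_nonzero[OF that] by (metis mono_degree_eq_bidegree)
  then show ?thesis
    unfolding sNCQSym_iff bounded_degree_def using antipode_std by blast
qed

section \<open>The Hopf superalgebra structure\<close>

lemma bilinear_on_eq_on_span:
  assumes \<mu>: "bilinear_on (fun_space.span B) (fun_space.span C) \<mu>"
    and \<mu>': "bilinear_on (fun_space.span B) (fun_space.span C) \<mu>'"
    and eq: "\<And>b c. b \<in> B \<Longrightarrow> c \<in> C \<Longrightarrow> \<mu> b c = \<mu>' b c"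
    and s: "s \<in> fun_space.span B" and t: "t \<in> fun_space.span C"
  shows "\<mu> s t = \<mu>' s t"
proof (rule linear_on_eq_on_span[OF _ _ _ t])
  show "linear_on (fun_space.span C) fscale (\<mu> s)" "linear_on (fun_space.span C) fscale (\<mu>' s)"
    using \<mu> \<mu>' s by (auto simp: bilinear_on_def)
  fix c assume c: "c \<in> C"
  then have "c \<in> fun_space.span C"
    by (rule fun_space.span_base)
  then have "linear_on (fun_space.span B) fscale (\<lambda>s. \<mu> s c)" "linear_on (fun_space.span B) fscale (\<lambda>s. \<mu>' s c)"
    using \<mu> \<mu>' by (auto simp: bilinear_on_def)
  from linear_on_eq_on_span[OF this eq[OF _ c] s] show "\<mu> s c = \<mu>' s c" .
qed

text \<open>The defining property fixes values only where the inner factors \<open>g\<^sub>1\<close>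
  and \<open>f\<^sub>2\<close> are homogeneous. Splitting a factor into parity parts shows that such
  tensors still span on either side, so the choice is determined; the spanning sets differ because
  homogeneity is imposed on opposite slots.\<close>

lemma super_tensor_mult_eq:
  assumes \<mu>: "bilinear_on (A \<otimes>\<^sub>S A) (A \<otimes>\<^sub>S A) \<mu>"
    and tensor: "\<And>p q f\<^sub>1 g\<^sub>1 f\<^sub>2 g\<^sub>2. f\<^sub>1 \<in> A \<Longrightarrow> g\<^sub>1 \<in> P p \<Longrightarrow> f\<^sub>2 \<in> P q \<Longrightarrow> g\<^sub>2 \<in> A \<Longrightarrow>
      \<mu> (f\<^sub>1 \<otimes>\<^sub>v g\<^sub>1) (f\<^sub>2 \<otimes>\<^sub>v g\<^sub>2) = fscale (koszul_sign q p) (mult f\<^sub>1 f\<^sub>2 \<otimes>\<^sub>v mult g\<^sub>1 g\<^sub>2)"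
    and decomp: "\<And>f. f \<in> A \<Longrightarrow> \<exists>f\<^sub>0\<in>P 0. \<exists>f\<^sub>1\<in>P 1. f = f\<^sub>0 + f\<^sub>1"
    and P: "\<And>p. P p \<subseteq> A"
    and s: "s \<in> A \<otimes>\<^sub>S A" and t: "t \<in> A \<otimes>\<^sub>S A"
  shows "super_tensor_mult A P mult s t = \<mu> s t"
proof -
  let ?Q = "\<lambda>\<mu>. bilinear_on (A \<otimes>\<^sub>S A) (A \<otimes>\<^sub>S A) \<mu> \<and>
        (\<forall>p q. \<forall>f\<^sub>1\<in>A. \<forall>g\<^sub>1\<in>P p. \<forall>f\<^sub>2\<in>P q. \<forall>g\<^sub>2\<in>A.
           \<mu> (f\<^sub>1 \<otimes>\<^sub>v g\<^sub>1) (f\<^sub>2 \<otimes>\<^sub>v g\<^sub>2) = fscale (koszul_sign q p) (mult f\<^sub>1 f\<^sub>2 \<otimes>\<^sub>v mult g\<^sub>1 g\<^sub>2))"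
  let ?\<mu>' = "super_tensor_mult A P mult"
  have Q: "?Q ?\<mu>'"
    unfolding super_tensor_mult_def by (rule someI[of ?Q \<mu>]) (use \<mu> tensor in blast)
  let ?B = "{f \<otimes>\<^sub>v g |f g. f \<in> A \<and> g \<in> (\<Union>p. P p)}" and ?C = "{f \<otimes>\<^sub>v g |f g. f \<in> (\<Union>p. P p) \<and> g \<in> A}"
  have B: "fun_space.span ?B = A \<otimes>\<^sub>S A"
  proof (rule antisym)
    show "fun_space.span ?B \<subseteq> A \<otimes>\<^sub>S A"
      unfolding tensor_space_def by (rule fun_space.span_mono) (use P in blast)
    show "A \<otimes>\<^sub>S A \<subseteq> fun_space.span ?B"
      unfolding tensor_space_def
    proof (rule fun_space.span_minimal[OF _ fun_space.subspace_span], rule subsetI)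
      fix x assume "x \<in> {f \<otimes>\<^sub>v g |f g. f \<in> A \<and> g \<in> A}"
      then obtain f g where x: "x = f \<otimes>\<^sub>v g" and f: "f \<in> A" and "g \<in> A"
        by blast
      then obtain g0 g1 where "g0 \<in> P 0" "g1 \<in> P 1" and g: "g = g0 + g1"
        using decomp by blast
      with f have "f \<otimes>\<^sub>v g0 \<in> ?B" "f \<otimes>\<^sub>v g1 \<in> ?B"
        by blast+
      then have "f \<otimes>\<^sub>v g0 + f \<otimes>\<^sub>v g1 \<in> fun_space.span ?B"
        by (intro fun_space.span_add fun_space.span_base)
      also have "f \<otimes>\<^sub>v g0 + f \<otimes>\<^sub>v g1 = x"
        by (auto simp: x g tensor_def fun_eq_iff algebra_simps)
      finally show "x \<in> fun_space.span ?B" .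
    qed
  qed
  have C: "fun_space.span ?C = A \<otimes>\<^sub>S A"
  proof (rule antisym)
    show "fun_space.span ?C \<subseteq> A \<otimes>\<^sub>S A"
      unfolding tensor_space_def by (rule fun_space.span_mono) (use P in blast)
    show "A \<otimes>\<^sub>S A \<subseteq> fun_space.span ?C"
      unfolding tensor_space_def
    proof (rule fun_space.span_minimal[OF _ fun_space.subspace_span], rule subsetI)
      fix x assume "x \<in> {f \<otimes>\<^sub>v g |f g. f \<in> A \<and> g \<in> A}"
      then obtain f g where x: "x = f \<otimes>\<^sub>v g" and "f \<in> A" and g: "g \<in> A"
        by blast
      then obtain f0 f1 where "f0 \<in> P 0" "f1 \<in> P 1" and f: "f = f0 + f1"
        using decomp by blast
      with g have "f0 \<otimes>\<^sub>v g \<in> ?C" "f1 \<otimes>\<^sub>v g \<in> ?C"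
        by blast+
      then have "f0 \<otimes>\<^sub>v g + f1 \<otimes>\<^sub>v g \<in> fun_space.span ?C"
        by (intro fun_space.span_add fun_space.span_base)
      also have "f0 \<otimes>\<^sub>v g + f1 \<otimes>\<^sub>v g = x"
        by (auto simp: x f tensor_def fun_eq_iff algebra_simps)
      finally show "x \<in> fun_space.span ?C" .
    qed
  qed
  show ?thesis
  proof (rule bilinear_on_eq_on_span[of ?B ?C ?\<mu>' \<mu>], unfold B C)
    fix b c assume "b \<in> ?B" "c \<in> ?C"
    then obtain f\<^sub>1 g\<^sub>1 f\<^sub>2 g\<^sub>2 p q where "b = f\<^sub>1 \<otimes>\<^sub>v g\<^sub>1" "c = f\<^sub>2 \<otimes>\<^sub>v g\<^sub>2" and
      fg: "f\<^sub>1 \<in> A" "g\<^sub>1 \<in> P p" "f\<^sub>2 \<in> P q" "g\<^sub>2 \<in> A"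
      by blast
    moreover have "?\<mu>' (f\<^sub>1 \<otimes>\<^sub>v g\<^sub>1) (f\<^sub>2 \<otimes>\<^sub>v g\<^sub>2) = fscale (koszul_sign q p) (mult f\<^sub>1 f\<^sub>2 \<otimes>\<^sub>v mult g\<^sub>1 g\<^sub>2)"
      using Q fg by blast
    ultimately show "?\<mu>' b c = \<mu> b c"
      using tensor[OF fg] by simp
  qed (use Q \<mu> s t in blast)+
qed

lemma bilinear_on_super_mult: "bilinear_on V W super_mult"
  unfolding bilinear_on_def
  by (intro conjI ballI linear_onI_fscale)
    (auto simp: super_mult_def fscale_def algebra_simps split_beta sum.distrib sum_distrib_left)

text \<open>On the supports of \<open>g\<^sub>1\<close> and \<open>f\<^sub>2\<close> the parities
  are constant, so the sign attached to each pair of monomials is the single Koszul sign and factors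
  out of the sum.\<close>

lemma super_mult_tensor:
  fixes f\<^sub>1 f\<^sub>2 :: "'i::linorder series" and g\<^sub>1 g\<^sub>2 :: "'j::linorder series"
  assumes g\<^sub>1: "\<And>v. g\<^sub>1 v \<noteq> 0 \<Longrightarrow> mono_parity v = p" and f\<^sub>2: "\<And>u. f\<^sub>2 u \<noteq> 0 \<Longrightarrow> mono_parity u = q"
  shows "super_mult (f\<^sub>1 \<otimes>\<^sub>v g\<^sub>1) (f\<^sub>2 \<otimes>\<^sub>v g\<^sub>2) =
    fscale (koszul_sign q p) (series_mult f\<^sub>1 f\<^sub>2 \<otimes>\<^sub>v series_mult g\<^sub>1 g\<^sub>2)"
proof
  fix uv :: "'i mono \<times> 'j mono"
  obtain u v where uv: "uv = (u, v)"
    by (cases uv)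
  have sign: "(-1) ^ (fcard (fst v\<^sub>1) * fcard (fst u\<^sub>2)) * (g\<^sub>1 v\<^sub>1 * f\<^sub>2 u\<^sub>2) = koszul_sign q p * (g\<^sub>1 v\<^sub>1 * f\<^sub>2 u\<^sub>2)" for v\<^sub>1 u\<^sub>2
  proof (cases "g\<^sub>1 v\<^sub>1 = 0 \<or> f\<^sub>2 u\<^sub>2 = 0")
    case False
    then have "mono_parity v\<^sub>1 = p" "mono_parity u\<^sub>2 = q"
      using g\<^sub>1 f\<^sub>2 by auto
    then have "(-1) ^ (fcard (fst v\<^sub>1) * fcard (fst u\<^sub>2)) = (koszul_sign q p :: rat)"
      by (auto simp: mono_parity_def koszul_sign_def split: if_splits)
    then show ?thesis
      by simp
  qed auto
  let ?F = "\<lambda>x. mono_sign (fst x) (snd x) * f\<^sub>1 (fst x) * f\<^sub>2 (snd x)"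
  let ?G = "\<lambda>y. mono_sign (fst y) (snd y) * g\<^sub>1 (fst y) * g\<^sub>2 (snd y)"
  have "super_mult (f\<^sub>1 \<otimes>\<^sub>v g\<^sub>1) (f\<^sub>2 \<otimes>\<^sub>v g\<^sub>2) (u, v) =
      (\<Sum>z\<in>factorizations u \<times> factorizations v. koszul_sign q p * (?F (fst z) * ?G (snd z)))"
    unfolding super_mult_def prod.case
  proof (rule sum.cong[OF refl])
    fix z assume "z \<in> factorizations u \<times> factorizations v"
    obtain u1 u2 v1 v2 where z: "z = ((u1, u2), (v1, v2))"
      by (metis prod.collapse)
    have "mono_sign u1 u2 * mono_sign v1 v2 * (-1) ^ (fcard (fst v1) * fcard (fst u2)) * (f\<^sub>1 u1 * g\<^sub>1 v1) * (f\<^sub>2 u2 * g\<^sub>2 v2) =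
        mono_sign u1 u2 * mono_sign v1 v2 * f\<^sub>1 u1 * g\<^sub>2 v2 * ((-1) ^ (fcard (fst v1) * fcard (fst u2)) * (g\<^sub>1 v1 * f\<^sub>2 u2))"
      by (simp only: ac_simps)
    also have "\<dots> = koszul_sign q p * ((mono_sign u1 u2 * f\<^sub>1 u1 * f\<^sub>2 u2) * (mono_sign v1 v2 * g\<^sub>1 v1 * g\<^sub>2 v2))"
      unfolding sign by (simp only: ac_simps)
    finally show "(\<lambda>((u\<^sub>1, u\<^sub>2), (v\<^sub>1, v\<^sub>2)). mono_sign u\<^sub>1 u\<^sub>2 * mono_sign v\<^sub>1 v\<^sub>2 * (-1) ^ (fcard (fst v\<^sub>1) * fcard (fst u\<^sub>2)) *
          (f\<^sub>1 \<otimes>\<^sub>v g\<^sub>1) (u\<^sub>1, v\<^sub>1) * (f\<^sub>2 \<otimes>\<^sub>v g\<^sub>2) (u\<^sub>2, v\<^sub>2)) z =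
        koszul_sign q p * (?F (fst z) * ?G (snd z))"
      by (simp only: z prod.case tensor_def fst_conv snd_conv)
  qed
  also have "\<dots> = koszul_sign q p * (sum ?F (factorizations u) * sum ?G (factorizations v))"
    by (simp only: sum_distrib_left[symmetric]) (simp only: sum_product sum.cartesian_product case_prod_unfold)
  also have "\<dots> = fscale (koszul_sign q p) (series_mult f\<^sub>1 f\<^sub>2 \<otimes>\<^sub>v series_mult g\<^sub>1 g\<^sub>2) (u, v)"
    by (simp add: fscale_def tensor_def series_mult_def split_beta)
  finally show "super_mult (f\<^sub>1 \<otimes>\<^sub>v g\<^sub>1) (f\<^sub>2 \<otimes>\<^sub>v g\<^sub>2) uv =
      fscale (koszul_sign q p) (series_mult f\<^sub>1 f\<^sub>2 \<otimes>\<^sub>v series_mult g\<^sub>1 g\<^sub>2) uv"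
    unfolding uv .
qed

section \<open>Gradings by parity and bidegree\<close>

lemma sNCQSym_restrict:
  assumes f: "f \<in> sNCQSym" and d: "\<And>u. d (mono_std u) = d u"
  shows "(\<lambda>u. if d u = i then f u else 0) \<in> sNCQSym"
  using f by (simp add: sNCQSym_iff bounded_degree_def d) meson

lemma mono_parity_std: "mono_parity (mono_std u) = mono_parity u"
  by (simp add: mono_parity_bidegree)

lemma finite_bidegree_support:
  assumes "f \<in> sNCQSym"
  shows "finite (mono_bidegree ` {u. f u \<noteq> 0})"
proof -
  obtain e where "\<And>u. f u \<noteq> 0 \<Longrightarrow> mono_degree u \<le> e"
    using sNCQSym_bounded[OF assms] by metis
  then have "fst (mono_bidegree u) \<le> e \<and> snd (mono_bidegree u) \<le> e" if "f u \<noteq> 0" for u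
    using that by (metis add_leD1 add_leD2 mono_degree_eq_bidegree)
  then have "mono_bidegree ` {u. f u \<noteq> 0} \<subseteq> {..e} \<times> {..e}"
    by (intro image_subsetI) (simp add: mem_Times_iff)
  then show ?thesis
    by (rule finite_subset) simp
qed

lemma finite_mono_parity_image: "finite (mono_parity ` U)"
  by (rule finite_subset[of _ "{0, 1}"]) (auto simp: mono_parity_def)

lemma direct_sum_bidegree: "direct_sum sNCQSym sNCQSym_bidegree"
  using subspace_sNCQSym sNCQSym_bidegree_eq sNCQSym_restrict[where d = mono_bidegree, OF _ mono_bidegree_std]
    finite_bidegree_support
  by (rule direct_sum_support)

lemma direct_sum_parity: "direct_sum sNCQSym sNCQSym_parity"
  using subspace_sNCQSym sNCQSym_parity_eq sNCQSym_restrict[where d = mono_parity, OF _ mono_parity_std]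
    finite_mono_parity_image
  by (rule direct_sum_support)

lemma direct_sum_bidegree_parity: "direct_sum (sNCQSym_bidegree a) (\<lambda>p. sNCQSym_bidegree a \<inter> sNCQSym_parity p)"
proof (rule direct_sum_support[where d = mono_parity])
  show "fun_space.subspace (sNCQSym_bidegree a)"
    unfolding sNCQSym_bidegree_eq by (rule subspace_support[OF subspace_sNCQSym])
  show "sNCQSym_bidegree a \<inter> sNCQSym_parity p = {f \<in> sNCQSym_bidegree a. \<forall>u. f u \<noteq> 0 \<longrightarrow> mono_parity u = p}" for p
    unfolding sNCQSym_bidegree_eq sNCQSym_parity_eq by blast
  show "(\<lambda>u. if mono_parity u = i then f u else 0) \<in> sNCQSym_bidegree a" if "f \<in> sNCQSym_bidegree a" for f i
    using that sNCQSym_restrict[where d = mono_parity, OF _ mono_parity_std, of f i]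
    unfolding sNCQSym_bidegree_eq by (auto split: if_splits)
qed (rule finite_mono_parity_image)

lemma mono_parity_add:
  "mono_bidegree w = mono_bidegree u + mono_bidegree v \<Longrightarrow> mono_parity w = mono_parity u + mono_parity v"
  by (simp add: mono_parity_bidegree)

lemma mono_parity_cong: "mono_bidegree u = mono_bidegree v \<Longrightarrow> mono_parity u = mono_parity v"
  by (simp add: mono_parity_bidegree)

lemma series_mult_homogeneous:
  assumes f: "\<And>u. f u \<noteq> 0 \<Longrightarrow> d u = i" and g: "\<And>u. g u \<noteq> 0 \<Longrightarrow> d u = j"
    and d: "\<And>u v w. mono_bidegree w = mono_bidegree u + mono_bidegree v \<Longrightarrow> d w = d u + d v"
    and nz: "series_mult f g w \<noteq> 0"
  shows "d w = i + j"
proof -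
  obtain u v where "f u \<noteq> 0" "g v \<noteq> 0" "mono_bidegree w = mono_bidegree u + mono_bidegree v"
    using nz by (rule series_mult_eq_0_or_bidegree)
  with f g d show ?thesis
    by metis
qed

lemma antipode_homogeneous:
  assumes "\<And>u. f u \<noteq> 0 \<Longrightarrow> d u = i"
    and "\<And>u v. mono_bidegree u = mono_bidegree v \<Longrightarrow> d u = d v"
    and "antipode f w \<noteq> 0"
  shows "d w = i"
  using antipode_nonzero[OF assms(3)] assms(1,2) by metis

lemma sNCQSym_parity_decomposition:
  assumes "f \<in> sNCQSym"
  shows "\<exists>f\<^sub>0\<in>sNCQSym_parity 0. \<exists>f\<^sub>1\<in>sNCQSym_parity 1. f = f\<^sub>0 + f\<^sub>1"
proof (intro bexI)
  let ?f = "\<lambda>p u. if mono_parity u = p then f u else 0"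
  show "f = ?f 0 + ?f 1"
    by (auto simp: fun_eq_iff)
  show "?f 0 \<in> sNCQSym_parity 0" "?f 1 \<in> sNCQSym_parity 1"
    using sNCQSym_restrict[where d = mono_parity, OF assms mono_parity_std]
    by (auto simp: sNCQSym_parity_eq)
qed

lemma linear_on_std_coproduct: "linear_on V fscale std_coproduct"
  by (rule linear_onI_fscale) (simp_all only: std_coproduct_add std_coproduct_scale)

lemma mono_parity_one: "mono_parity mono_one = 0"
  by (simp add: mono_parity_def fcard.rep_eq)

lemma superalgebra_sNCQSym:
  "superalgebra sNCQSym sNCQSym_parity series_mult series_one"
proof (rule superalgebra.intro)
  show "direct_sum sNCQSym sNCQSym_parity"
    by (rule direct_sum_parity)
  show "bilinear_on sNCQSym sNCQSym series_mult"
    by (rule bilinear_on_series_mult)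
  fix f g h :: "nat series"
  show "series_mult series_one f = f" "series_mult f series_one = f"
    by (rule series_mult_one_left, rule series_mult_one_right)
  show "series_mult (series_mult f g) h = series_mult f (series_mult g h)"
    by (rule series_mult_assoc)
  show "f \<in> sNCQSym \<Longrightarrow> g \<in> sNCQSym \<Longrightarrow> series_mult f g \<in> sNCQSym"
    by (rule series_mult_in_sNCQSym)
  show "series_one \<in> sNCQSym_parity 0"
    using series_one_in_sNCQSym by (auto simp: sNCQSym_parity_eq series_one_def mono_parity_one split: if_splits)
  show "series_mult f g \<in> sNCQSym_parity (p + q)" if "f \<in> sNCQSym_parity p" "g \<in> sNCQSym_parity q" for p q
    using that series_mult_in_sNCQSym series_mult_homogeneous[of f mono_parity p g q, OF _ _ mono_parity_add]
    unfolding sNCQSym_parity_eq by blast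
qed

lemma super_coalgebra_sNCQSym:
  "super_coalgebra sNCQSym sNCQSym_parity coproduct counit"
proof (rule super_coalgebra.intro)
  show "direct_sum sNCQSym sNCQSym_parity"
    by (rule direct_sum_parity)
  show "linear_on sNCQSym fscale coproduct"
    using linear_on_std_coproduct[of sNCQSym] subspace_sNCQSym
    unfolding linear_on_def
    by (simp add: coproduct_eq_std_coproduct fun_space.subspace_add fun_space.subspace_scale)
  show "linear_on sNCQSym (*) counit"
    by (simp add: linear_on_def counit_def fscale_def)
  show "coproduct f \<in> tensor_grading sNCQSym_parity p" if "f \<in> sNCQSym_parity p" for f p
  proof -
    have f: "f \<in> sNCQSym" and hom: "\<And>u. f u \<noteq> 0 \<Longrightarrow> mono_parity u = p"
      using that by (auto simp: sNCQSym_parity_eq)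
    show ?thesis
      unfolding coproduct_eq_std_coproduct[OF f]
      using f hom mono_parity_add mono_parity_cong sNCQSym_parity_eq by (rule std_coproduct_in_tensor_grading)
  qed
  show "counit f = 0" if "f \<in> sNCQSym_parity 1" for f
  proof (rule ccontr)
    assume "counit f \<noteq> 0"
    then have "mono_parity (mono_one :: nat mono) = 1"
      using that unfolding counit_def sNCQSym_parity_eq by blast
    then show False
      by (simp add: mono_parity_one)
  qed
  fix f assume f: "f \<in> sNCQSym"
  note cop = coproduct_eq_std_coproduct[OF f] and T = std_coproduct_in_tensor_space[OF f]
  have std: "std_coproduct g = coproduct g" if "g \<in> sNCQSym" for g
    using coproduct_eq_std_coproduct[OF that] ..
  show "coproduct f \<in> sNCQSym \<otimes>\<^sub>S sNCQSym"
    unfolding cop by (rule T)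
  \<comment> \<open>Linearity of \<open>coproduct\<close> is known only on \<open>sNCQSym\<close>;
    \<open>std_coproduct\<close> agrees with it there and is linear everywhere, so it can act on
    slices.\<close>
  have "tensor_map sNCQSym sNCQSym coproduct id (std_coproduct f) =
      (\<lambda>(x, v). std_coproduct (\<lambda>a. std_coproduct f (a, v)) x)"
    using linear_on_std_coproduct std T by (rule tensor_map_left)
  moreover have "tensor_map sNCQSym sNCQSym id coproduct (std_coproduct f) =
      (\<lambda>(v, x). std_coproduct (\<lambda>a. std_coproduct f (v, a)) x)"
    using linear_on_std_coproduct std T by (rule tensor_map_right)
  ultimately show "tensor_map sNCQSym sNCQSym coproduct id (coproduct f) =
      tensor_assoc (tensor_map sNCQSym sNCQSym id coproduct (coproduct f))"
    unfolding cop by (auto simp: tensor_assoc_def std_coproduct_coassoc)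
  show "tensor_lift sNCQSym sNCQSym (\<lambda>g h. fscale (counit g) h) (coproduct f) = f"
  proof -
    \<comment> \<open>The counit evaluates at the empty monomial, so contracting with it takes the
      slice there.\<close>
    have "tensor_lift sNCQSym sNCQSym (\<lambda>g h. fscale (counit g) h) (std_coproduct f) =
        (\<lambda>v. std_coproduct f (mono_one :: nat mono, v))"
      by (rule tensor_lift_eq[OF _ _ T]) (auto intro!: linear_onI_fscale simp: fscale_def tensor_def counit_def)
    then show ?thesis
      by (simp add: cop std_coproduct_one_left sNCQSym_std[OF f])
  qed
  show "tensor_lift sNCQSym sNCQSym (\<lambda>g h. fscale (counit h) g) (coproduct f) = f"
  proof -
    have "tensor_lift sNCQSym sNCQSym (\<lambda>g h. fscale (counit h) g) (std_coproduct f) =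
        (\<lambda>u. std_coproduct f (u, mono_one :: nat mono))"
      by (rule tensor_lift_eq[OF _ _ T]) (auto intro!: linear_onI_fscale simp: fscale_def tensor_def counit_def)
    then show ?thesis
      by (simp add: cop std_coproduct_one_right sNCQSym_std[OF f])
  qed
qed

lemma super_bialgebra_sNCQSym:
  "super_bialgebra sNCQSym sNCQSym_parity series_mult series_one coproduct counit"
proof (intro super_bialgebra.intro superalgebra_sNCQSym super_coalgebra_sNCQSym super_bialgebra_axioms.intro)
  fix f g assume f: "f \<in> sNCQSym" and g: "g \<in> sNCQSym"
  have "super_tensor_mult sNCQSym sNCQSym_parity series_mult (std_coproduct f) (std_coproduct g) =
      super_mult (std_coproduct f) (std_coproduct g)"
    using bilinear_on_super_mult _ sNCQSym_parity_decomposition _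
      std_coproduct_in_tensor_space[OF f] std_coproduct_in_tensor_space[OF g]
    by (rule super_tensor_mult_eq) (auto simp: sNCQSym_parity_eq intro!: super_mult_tensor)
  also have "\<dots> = std_coproduct (series_mult f g)"
    by (simp only: std_coproduct_def std_extend_series_mult[OF f g] project_series_mult)
  finally show "coproduct (series_mult f g) =
      super_tensor_mult sNCQSym sNCQSym_parity series_mult (coproduct f) (coproduct g)"
    by (simp only: coproduct_eq_std_coproduct series_mult_in_sNCQSym f g)
  show "counit (series_mult f g) = counit f * counit g"
    by (rule counit_mult)
next
  show "counit series_one = 1"
    by (simp add: counit_def series_one_def)
  show "coproduct series_one = series_one \<otimes>\<^sub>v series_one"
  proof
    fix t :: "nat mono \<times> nat mono"
    obtain u v where t: "t = (u, v)"
      by (cases t)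
    have one: "series_one (mono_std z) = series_one z" for z :: "(nat + nat) mono"
      by (simp add: series_one_def)
    have split: "mono_split z = (mono_one, mono_one) \<longleftrightarrow> z = mono_one" for z :: "(nat + nat) mono"
      unfolding mono_split_eq_one_left by (simp add: mono_map_def)
    have "std_coproduct series_one (u, v) = (series_one \<otimes>\<^sub>v series_one) (u, v)"
    proof (cases "u = mono_one \<and> v = mono_one")
      case True
      then show ?thesis
        unfolding std_coproduct_apply one by (simp add: split tensor_def) (simp add: series_one_def)
    next
      case False
      then have "series_one z = 0" if "mono_split z = (u, v)" for z :: "(nat + nat) mono"
        using that split[of z] by (auto simp: series_one_def)
      then show ?thesis
        using False unfolding std_coproduct_apply one by (auto simp: tensor_def) (auto simp: series_one_def)
    qed
    then show "coproduct series_one t = (series_one \<otimes>\<^sub>v series_one) t"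
      by (simp add: t coproduct_eq_std_coproduct series_one_in_sNCQSym)
  qed
qed

lemma tensor_lift_series_mult:
  assumes "t \<in> V \<otimes>\<^sub>S W"
  shows "tensor_lift V W series_mult t = (\<lambda>w. \<Sum>p\<in>factorizations w. mono_sign (fst p) (snd p) * t p)"
proof (rule tensor_lift_eq[OF _ _ assms])
  show "linear_on (V \<otimes>\<^sub>S W) fscale (\<lambda>t w. \<Sum>p\<in>factorizations w. mono_sign (fst p) (snd p) * t p)"
    by (rule linear_onI_fscale) (simp_all add: fscale_def sum_distrib_left sum.distrib algebra_simps)
  show "(\<lambda>w. \<Sum>p\<in>factorizations w. mono_sign (fst p) (snd p) * (f \<otimes>\<^sub>v g) p) = series_mult f g" for f g
    by (simp add: series_mult_def tensor_def split_beta mult.assoc)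
qed

lemma hopf_superalgebra_sNCQSym:
  "hopf_superalgebra sNCQSym sNCQSym_parity series_mult series_one coproduct counit antipode"
proof (intro hopf_superalgebra.intro super_bialgebra_sNCQSym hopf_superalgebra_axioms.intro)
  show "linear_on sNCQSym fscale antipode"
    using linear_on_antipode by (auto simp: linear_on_def)
  show "f \<in> sNCQSym \<Longrightarrow> antipode f \<in> sNCQSym" for f
    by (rule antipode_in_sNCQSym)
  show "antipode f \<in> sNCQSym_parity p" if "f \<in> sNCQSym_parity p" for f p
    using that antipode_in_sNCQSym antipode_homogeneous[of f mono_parity, OF _ mono_parity_cong]
    unfolding sNCQSym_parity_eq by blast
  fix f assume f: "f \<in> sNCQSym"
  note cop = coproduct_eq_std_coproduct[OF f] and T = std_coproduct_in_tensor_space[OF f]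
  have one: "(\<lambda>w. if w = mono_one then counit f else 0) = fscale (counit f) series_one"
    by (auto simp: fscale_def series_one_def)
  \<comment> \<open>The outer \<open>tensor_lift\<close> is determined only on the tensor space, so
    its argument must be shown to lie there.\<close>
  have "(\<lambda>(x, v). antipode (\<lambda>a. std_coproduct f (a, v)) x) \<in> sNCQSym \<otimes>\<^sub>S sNCQSym"
    using linear_on_apply_left[OF linear_on_antipode] _ T
    by (rule linear_on_tensor_space_closed)
      (simp only: apply_left_tensor[OF linear_on_antipode] tensor_in_tensor_space antipode_in_sNCQSym)
  then show "tensor_lift sNCQSym sNCQSym series_mult (tensor_map sNCQSym sNCQSym antipode id (coproduct f)) =
      fscale (counit f) series_one"
    unfolding cop tensor_map_left[OF linear_on_antipode refl T]
    by (simp only: tensor_lift_series_mult split_beta antipode_convolution one)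
  have "(\<lambda>(v, x). antipode (\<lambda>a. std_coproduct f (v, a)) x) \<in> sNCQSym \<otimes>\<^sub>S sNCQSym"
    using linear_on_apply_right[OF linear_on_antipode] _ T
    by (rule linear_on_tensor_space_closed)
      (simp only: apply_right_tensor[OF linear_on_antipode] tensor_in_tensor_space antipode_in_sNCQSym)
  \<comment> \<open>The convolution identity on this side belongs to \<open>right_antipode\<close>
    and transfers because the two antipodes coincide.\<close>
  then show "tensor_lift sNCQSym sNCQSym series_mult (tensor_map sNCQSym sNCQSym id antipode (coproduct f)) =
      fscale (counit f) series_one"
    unfolding cop tensor_map_right[OF linear_on_antipode refl T]
    by (simp only: tensor_lift_series_mult split_beta)
      (simp only: antipode_eq_right_antipode right_antipode_convolution one)
qed

theorem theorem4p5:
  shows "\<exists>S. graded_hopf_superalgebra sNCQSym sNCQSym_parity series_mult series_one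
               coproduct counit S sNCQSym_bidegree"
proof (intro exI)
  show "graded_hopf_superalgebra sNCQSym sNCQSym_parity series_mult series_one
      coproduct counit antipode sNCQSym_bidegree"
  proof (intro graded_hopf_superalgebra.intro hopf_superalgebra_sNCQSym graded_hopf_superalgebra_axioms.intro)
    show "direct_sum sNCQSym sNCQSym_bidegree"
      by (rule direct_sum_bidegree)
    show "direct_sum (sNCQSym_bidegree a) (\<lambda>p. sNCQSym_bidegree a \<inter> sNCQSym_parity p)" for a
      by (rule direct_sum_bidegree_parity)
    show "series_mult f g \<in> sNCQSym_bidegree (a + b)"
      if "f \<in> sNCQSym_bidegree a" "g \<in> sNCQSym_bidegree b" for f g a b
      using that series_mult_in_sNCQSym series_mult_homogeneous[of f mono_bidegree a g b]
      unfolding sNCQSym_bidegree_eq by blast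
    show "series_one \<in> sNCQSym_bidegree 0"
      using series_one_in_sNCQSym
      by (auto simp: sNCQSym_bidegree_eq series_one_def mono_bidegree_eq_0_iff split: if_splits)
    show "coproduct f \<in> tensor_grading sNCQSym_bidegree a" if "f \<in> sNCQSym_bidegree a" for f a
    proof -
      have f: "f \<in> sNCQSym" and hom: "\<And>u. f u \<noteq> 0 \<Longrightarrow> mono_bidegree u = a"
        using that by (auto simp: sNCQSym_bidegree_eq)
      show ?thesis
        unfolding coproduct_eq_std_coproduct[OF f]
        using f hom _ _ sNCQSym_bidegree_eq by (rule std_coproduct_in_tensor_grading) simp_all
    qed
    show "counit f = 0" if "f \<in> sNCQSym_bidegree a" "a \<noteq> 0" for f a
    proof (rule ccontr)
      assume "counit f \<noteq> 0"
      then have "mono_bidegree (mono_one :: nat mono) = a"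
        using that(1) unfolding counit_def sNCQSym_bidegree_eq by blast
      with that(2) show False
        using mono_bidegree_eq_0_iff[of "mono_one :: nat mono"] by simp
    qed
    show "antipode f \<in> sNCQSym_bidegree a" if "f \<in> sNCQSym_bidegree a" for f a
      using that antipode_in_sNCQSym antipode_homogeneous[of f mono_bidegree, OF _ _]
      unfolding sNCQSym_bidegree_eq by blast
  qed
qed

end
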